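(* Let $R$ be an Abelian d-rag. Then $(\mathbf V^R, \eta, \_^\dagger, t)$ and $(\mathbf V^R_m, \eta, \_^\dagger, t)$ are strong monads on the category $\mathbf{Dcpo}$ of dcpos and Scott-continuous maps (for $\mathbf V^R_m$, the operations $\eta$, $\_^\dagger$ and $t$ are given by the same formulas as for $\mathbf V^R$, restricted to minimal $R$-valuations).
   Context: A dcpo is a poset in which every directed family has a supremum; dcpos are always given their Scott topology. A rag is a tuple $(R,0,+,1,\times)$ where $(R,0,+)$ is an Abelian monoid, $(R,1,\times)$ is a monoid, and $\times$ distributes over $+$ (it is not required that $0\times r=0$). It is Abelian if $\times$ is commutative. A d-rag is a rag with an ordering making it a dcpo such that $+$ and $\times$ are Scott-continuous. For a topological space $X$ (a dcpo being given its Scott topology), $\mathcal L^R X$ is the dcpo of all continuous maps $X\to R$ ($R$ with its Scott topology), ordered pointwise. A continuous $R$-valuation on $X$ is a Scott-continuous map $\nu:\mathcal L^R X\to R$ with $\nu(\mathbf a\times h)=\mathbf a\times\nu(h)$ and $\nu(h+h')=\nu(h)+\nu(h')$ for all $\mathbf a\in R$, $h,h'\in\mathcal L^R X$. $\mathbf V^R X$ is the dcpo of all continuous $R$-valuations on $X$ with the pointwise ordering. $\delta_x\in\mathbf V^R X$ is $h\mapsto h(x)$. An elementary $R$-valuation is one of the form $h\mapsto\sum_{i=1}^n r_i\times h(x_i)$ with $n\ge 1$, $r_i\in R$, $x_i\in X$; $\mathbf V^R_{\mathrm f}X$ is the set of these. $\mathbf V^R_m X$ (the minimal $R$-valuations)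 is the inductive closure of $\mathbf V^R_{\mathrm f}X$ in $\mathbf V^R X$, i.e. the smallest subset containing $\mathbf V^R_{\mathrm f}X$ and closed under directed suprema, with the induced ordering. The structure: $\eta_X(x)=\delta_x$; for Scott-continuous $f:X\to\mathbf V^R Y$, $f^\dagger(\nu)(k)=\nu(\lambda x\in X.\,f(x)(k))$ for $\nu\in\mathbf V^R X$, $k\in\mathcal L^R Y$; $t_{X,Y}:X\times\mathbf V^R Y\to\mathbf V^R(X\times Y)$ is $t_{X,Y}(x,\nu)(h)=\nu(\lambda y\in Y.\,h(x,y))$ for $h\in\mathcal L^R(X\times Y)$. A monad in Manes' presentation on a category $\mathbf C$ consists of an object map $T$, morphisms $\eta_X:X\to TX$, and for each $f:X\to TY$ a morphism $f^\dagger:TX\to TY$, satisfying $f^\dagger\circ\eta_X=f$, $\eta_X^\dagger=\mathrm{id}_{TX}$, $(g^\dagger\circ f)^\dagger=g^\dagger\circ f^\dagger$. It is strong when equipped with a tensorial strength $t_{X,Y}:X\times TY\to T(X\times Y)$, natural in $X$ and $Y$ and satisfying Moggi's usual coherence conditions (compatibility with the unit and associativity isomorphisms of products, with $\eta$ and with the monad multiplication). *)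

theory Defs
  imports "HOL-Algebra.Order" "HOL-Analysis.Abstract_Topology"
begin

section \<open>Dcpos\<close>

text \<open>
  Posets are the partial orders of HOL-Algebra, with an explicit and possibly empty carrier.
\<close>

definition directed :: "'a gorder \<Rightarrow> 'a set \<Rightarrow> bool" where
  "directed P D \<longleftrightarrow> D \<subseteq> carrier P \<and> D \<noteq> {} \<and>
     (\<forall>x\<in>D. \<forall>y\<in>D. \<exists>z\<in>D. x \<sqsubseteq>\<^bsub>P\<^esub> z \<and> y \<sqsubseteq>\<^bsub>P\<^esub> z)"

definition dcpo :: "'a gorder \<Rightarrow> bool" where
  "dcpo P \<longleftrightarrow> partial_order P \<and> (\<forall>D. directed P D \<longrightarrow> (\<exists>s. is_lub P s D))"

definition scott_continuous :: "'a gorder \<Rightarrow> 'b gorder \<Rightarrow> ('a \<Rightarrow> 'b) \<Rightarrow> bool" where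
  "scott_continuous P Q f \<longleftrightarrow> f \<in> carrier P \<rightarrow> carrier Q \<and>
     (\<forall>x\<in>carrier P. \<forall>y\<in>carrier P. x \<sqsubseteq>\<^bsub>P\<^esub> y \<longrightarrow> f x \<sqsubseteq>\<^bsub>Q\<^esub> f y) \<and>
     (\<forall>D s. directed P D \<and> is_lub P s D \<longrightarrow> is_lub Q (f s) (f ` D))"

definition scott_open :: "'a gorder \<Rightarrow> 'a set \<Rightarrow> bool" where
  "scott_open P U \<longleftrightarrow> U \<subseteq> carrier P \<and>
     (\<forall>x\<in>U. \<forall>y\<in>carrier P. x \<sqsubseteq>\<^bsub>P\<^esub> y \<longrightarrow> y \<in> U) \<and>
     (\<forall>D s. directed P D \<and> is_lub P s D \<and> s \<in> U \<longrightarrow> D \<inter> U \<noteq> {})"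

definition scott :: "'a gorder \<Rightarrow> 'a topology" where
  "scott P = topology (scott_open P)"

lemma scott_open_directed:
  assumes "scott_open P U" "directed P D" "is_lub P s D" "s \<in> U"
  shows "D \<inter> U \<noteq> {}"
proof -
  have "directed P D \<and> is_lub P s D \<and> s \<in> U \<longrightarrow> D \<inter> U \<noteq> {}"
    using assms(1) unfolding scott_open_def by (elim conjE allE)
  with assms(2-4) show ?thesis by (elim impE conjI)
qed

lemma istopology_scott_open: "istopology (scott_open P)"
  unfolding istopology_def
proof (intro conjI allI impI)
  fix S T assume S: "scott_open P S" and T: "scott_open P T"
  show "scott_open P (S \<inter> T)"
    unfolding scott_open_def
  proof (intro conjI allI impI)
    show "S \<inter> T \<subseteq> carrier P" using S by (auto simp: scott_open_def)
    show "\<forall>x\<in>S \<inter> T. \<forall>y\<in>carrier P. x \<sqsubseteq>\<^bsub>P\<^esub> y \<longrightarrow> y \<in> S \<inter> T"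
    proof (intro ballI impI)
      fix x y assume xy: "x \<in> S \<inter> T" "y \<in> carrier P" "x \<sqsubseteq>\<^bsub>P\<^esub> y"
      then have "x \<in> S" "x \<in> T" by simp_all
      then have "y \<in> S" "y \<in> T" using S T xy(2,3) by (simp_all add: scott_open_def)
      then show "y \<in> S \<inter> T" by simp
    qed
    fix D s assume *: "directed P D \<and> is_lub P s D \<and> s \<in> S \<inter> T"
    then have "D \<inter> S \<noteq> {}" "D \<inter> T \<noteq> {}"
      using scott_open_directed[OF S, of D s] scott_open_directed[OF T, of D s] by simp_all
    then obtain x y where x: "x \<in> D" "x \<in> S" and y: "y \<in> D" "y \<in> T"
      by auto
    moreover have "\<forall>x\<in>D. \<forall>y\<in>D. \<exists>z\<in>D. x \<sqsubseteq>\<^bsub>P\<^esub> z \<and> y \<sqsubseteq>\<^bsub>P\<^esub> z" and D: "D \<subseteq> carrier P"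
      using * by (simp_all add: directed_def)
    ultimately obtain z where z: "z \<in> D" "x \<sqsubseteq>\<^bsub>P\<^esub> z" "y \<sqsubseteq>\<^bsub>P\<^esub> z"
      by meson
    have "z \<in> carrier P" using D z(1) by (rule subsetD)
    then have "z \<in> S" "z \<in> T"
      using S T x(2) y(2) z(2,3) by (simp_all add: scott_open_def)
    then show "D \<inter> (S \<inter> T) \<noteq> {}" using z(1) by auto
  qed
next
  fix K assume K: "\<forall>U\<in>K. scott_open P U"
  show "scott_open P (\<Union>K)"
    unfolding scott_open_def
  proof (intro conjI allI impI)
    show "\<Union>K \<subseteq> carrier P" using K by (auto simp: scott_open_def)
    show "\<forall>x\<in>\<Union>K. \<forall>y\<in>carrier P. x \<sqsubseteq>\<^bsub>P\<^esub> y \<longrightarrow> y \<in> \<Union>K"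
    proof (intro ballI impI)
      fix x y assume xy: "x \<in> \<Union>K" "y \<in> carrier P" "x \<sqsubseteq>\<^bsub>P\<^esub> y"
      then obtain U where U: "U \<in> K" "x \<in> U" by auto
      then have "y \<in> U" using K xy by (simp add: scott_open_def)
      then show "y \<in> \<Union>K" using U(1) by auto
    qed
    fix D s assume *: "directed P D \<and> is_lub P s D \<and> s \<in> \<Union>K"
    then obtain U where U: "U \<in> K" "s \<in> U" by auto
    then have "D \<inter> U \<noteq> {}" using K * scott_open_directed[of P U D s] by simp
    then show "D \<inter> \<Union>K \<noteq> {}" using U(1) by auto
  qed
qed

lemma openin_scott: "openin (scott P) = scott_open P"
  by (simp add: scott_def istopology_scott_open topology_inverse')

lemma topspace_scott: "topspace (scott P) = carrier P"
proof -
  have "scott_open P (carrier P)"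
    by (auto simp: scott_open_def directed_def)
  then show ?thesis
    by (auto simp: topspace_def openin_scott scott_open_def)
qed


section \<open>The category of dcpos\<close>

text \<open>Morphisms are extensional functions, so that equality of morphisms is equality in HOL;
  composition is \<open>compose\<close>.\<close>

definition dcpo_hom :: "'a gorder \<Rightarrow> 'b gorder \<Rightarrow> ('a \<Rightarrow> 'b) set" where
  "dcpo_hom P Q = {f \<in> extensional (carrier P). scott_continuous P Q f}"

definition id_hom :: "'a gorder \<Rightarrow> 'a \<Rightarrow> 'a" where
  "id_hom P = (\<lambda>x\<in>carrier P. x)"

definition prod_dcpo :: "'a gorder \<Rightarrow> 'b gorder \<Rightarrow> ('a \<times> 'b) gorder" (infixr \<open>\<otimes>\<^sub>d\<close> 80) where
  "P \<otimes>\<^sub>d Q = \<lparr>carrier = carrier P \<times> carrier Q, eq = (=),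
     le = (\<lambda>p q. fst p \<sqsubseteq>\<^bsub>P\<^esub> fst q \<and> snd p \<sqsubseteq>\<^bsub>Q\<^esub> snd q)\<rparr>"

definition one_dcpo :: "unit gorder" where
  "one_dcpo = \<lparr>carrier = UNIV, eq = (=), le = (\<lambda>_ _. True)\<rparr>"

definition prod_hom :: "'a gorder \<Rightarrow> 'b gorder \<Rightarrow> ('a \<Rightarrow> 'c) \<Rightarrow> ('b \<Rightarrow> 'd) \<Rightarrow> 'a \<times> 'b \<Rightarrow> 'c \<times> 'd" where
  "prod_hom P Q f g = (\<lambda>(x, y)\<in>carrier (P \<otimes>\<^sub>d Q). (f x, g y))"

definition unitor :: "'a gorder \<Rightarrow> unit \<times> 'a \<Rightarrow> 'a" where
  "unitor P = (\<lambda>(u, x)\<in>carrier (one_dcpo \<otimes>\<^sub>d P). x)"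

definition assoc :: "'a gorder \<Rightarrow> 'b gorder \<Rightarrow> 'c gorder \<Rightarrow> ('a \<times> 'b) \<times> 'c \<Rightarrow> 'a \<times> ('b \<times> 'c)" where
  "assoc P Q S = (\<lambda>((x, y), z)\<in>carrier ((P \<otimes>\<^sub>d Q) \<otimes>\<^sub>d S). (x, (y, z)))"


section \<open>Rags and d-rags\<close>

text \<open>Unlike in a semiring with zero, \<open>0 * r = 0\<close> is not required: the class \<open>semiring\<close>
  has no constants.\<close>

class rag = semiring + comm_monoid_add + monoid_mult

definition (in order) order_poset :: "'a gorder" where
  "order_poset = \<lparr>carrier = UNIV, eq = (=), le = (\<le>)\<rparr>"

class d_rag = rag + order +
  assumes dcpo_order_poset: "dcpo order_poset"
    and scott_continuous_plus:
      "scott_continuous (order_poset \<otimes>\<^sub>d order_poset) order_poset (\<lambda>(a, b). a + b)"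
    and scott_continuous_times:
      "scott_continuous (order_poset \<otimes>\<^sub>d order_poset) order_poset (\<lambda>(a, b). a * b)"

class abelian_d_rag = d_rag + comm_monoid_mult


section \<open>Continuous and minimal valuations\<close>

text \<open>
  The d-rag \<open>R\<close> is a type \<open>'r\<close>; an argument of type \<open>'r itself\<close> names it.
  Since maps into \<open>R\<close> and valuations are extensional functions, the pointwise orders below are
  antisymmetric.
\<close>

definition cont_maps :: "'r::order itself \<Rightarrow> 'x topology \<Rightarrow> ('x \<Rightarrow> 'r) gorder" where
  "cont_maps R X = \<lparr>carrier = {h \<in> extensional (topspace X). continuous_map X (scott order_poset) h},
     eq = (=), le = (\<lambda>h h'. \<forall>x\<in>topspace X. h x \<le> h' x)\<rparr>"

definition valuations :: "'r::d_rag itself \<Rightarrow> 'x topology \<Rightarrow> (('x \<Rightarrow> 'r) \<Rightarrow> 'r) gorder" where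
  "valuations R X = \<lparr>carrier = {\<nu> \<in> extensional (carrier (cont_maps R X)).
       scott_continuous (cont_maps R X) order_poset \<nu> \<and>
       (\<forall>a. \<forall>h\<in>carrier (cont_maps R X). \<nu> (\<lambda>x\<in>topspace X. a * h x) = a * \<nu> h) \<and>
       (\<forall>h\<in>carrier (cont_maps R X). \<forall>h'\<in>carrier (cont_maps R X).
          \<nu> (\<lambda>x\<in>topspace X. h x + h' x) = \<nu> h + \<nu> h')},
     eq = (=), le = (\<lambda>\<nu> \<nu>'. \<forall>h\<in>carrier (cont_maps R X). \<nu> h \<le> \<nu>' h)\<rparr>"

definition elementary_valuations ::
    "'r::d_rag itself \<Rightarrow> 'x topology \<Rightarrow> (('x \<Rightarrow> 'r) \<Rightarrow> 'r) set" where
  "elementary_valuations R X = {\<nu> \<in> carrier (valuations R X).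
     \<exists>(n::nat) r x. n \<ge> 1 \<and> (\<forall>i\<in>{1..n}. x i \<in> topspace X) \<and>
       \<nu> = (\<lambda>h\<in>carrier (cont_maps R X). \<Sum>i=1..n. r i * h (x i))}"

definition inductive_closure :: "'a gorder \<Rightarrow> 'a set \<Rightarrow> 'a set" where
  "inductive_closure P B = \<Inter>{A. B \<subseteq> A \<and> A \<subseteq> carrier P \<and>
     (\<forall>D s. directed P D \<and> D \<subseteq> A \<and> is_lub P s D \<longrightarrow> s \<in> A)}"

definition minimal_valuations :: "'r::d_rag itself \<Rightarrow> 'x topology \<Rightarrow> (('x \<Rightarrow> 'r) \<Rightarrow> 'r) gorder" where
  "minimal_valuations R X =
     (valuations R X)\<lparr>carrier := inductive_closure (valuations R X) (elementary_valuations R X)\<rparr>"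


section \<open>The monad structures\<close>

text \<open>HOL has no type of all dcpos, so the object map is a polymorphic constant and the laws of
  a strong monad are to be stated for arbitrary dcpos over arbitrary types.
  The two monads differ only in the object map, which is selected by a tag; the remaining
  structure is given by the same formulas, restricted to the respective carriers.\<close>

datatype valuation_kind = Continuous | Minimal

fun \<V> :: "valuation_kind \<Rightarrow> 'r::d_rag itself \<Rightarrow> 'x gorder \<Rightarrow> (('x \<Rightarrow> 'r) \<Rightarrow> 'r) gorder" where
  "\<V> Continuous R X = valuations R (scott X)"
| "\<V> Minimal R X = minimal_valuations R (scott X)"

definition \<eta> :: "'r::d_rag itself \<Rightarrow> 'x gorder \<Rightarrow> 'x \<Rightarrow> ('x \<Rightarrow> 'r) \<Rightarrow> 'r" where
  "\<eta> R X = (\<lambda>x\<in>carrier X. \<lambda>h\<in>carrier (cont_maps R (scott X)). h x)"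

text \<open>\<open>ext k R X Y f\<close> is the Kleisli extension of \<open>f: X \<rightarrow> \<V> Y\<close>.\<close>

definition ext :: "valuation_kind \<Rightarrow> 'r::d_rag itself \<Rightarrow> 'x gorder \<Rightarrow> 'y gorder \<Rightarrow>
    ('x \<Rightarrow> ('y \<Rightarrow> 'r) \<Rightarrow> 'r) \<Rightarrow> (('x \<Rightarrow> 'r) \<Rightarrow> 'r) \<Rightarrow> ('y \<Rightarrow> 'r) \<Rightarrow> 'r" where
  "ext k R X Y f = (\<lambda>\<nu>\<in>carrier (\<V> k R X). \<lambda>h\<in>carrier (cont_maps R (scott Y)).
     \<nu> (\<lambda>x\<in>carrier X. f x h))"

definition strength :: "valuation_kind \<Rightarrow> 'r::d_rag itself \<Rightarrow> 'x gorder \<Rightarrow> 'y gorder \<Rightarrow>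
    'x \<times> (('y \<Rightarrow> 'r) \<Rightarrow> 'r) \<Rightarrow> ('x \<times> 'y \<Rightarrow> 'r) \<Rightarrow> 'r" where
  "strength k R X Y = (\<lambda>(x, \<nu>)\<in>carrier (X \<otimes>\<^sub>d \<V> k R Y).
     \<lambda>h\<in>carrier (cont_maps R (scott (X \<otimes>\<^sub>d Y))). \<nu> (\<lambda>y\<in>carrier Y. h (x, y)))"

text \<open>The action on morphisms and the multiplication, as derived from a Manes monad.\<close>

definition \<V>_map :: "valuation_kind \<Rightarrow> 'r::d_rag itself \<Rightarrow> 'x gorder \<Rightarrow> 'y gorder \<Rightarrow>
    ('x \<Rightarrow> 'y) \<Rightarrow> (('x \<Rightarrow> 'r) \<Rightarrow> 'r) \<Rightarrow> ('y \<Rightarrow> 'r) \<Rightarrow> 'r" where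
  "\<V>_map k R X Y g = ext k R X Y (compose (carrier X) (\<eta> R Y) g)"

definition \<mu> :: "valuation_kind \<Rightarrow> 'r::d_rag itself \<Rightarrow> 'x gorder \<Rightarrow>
    (((('x \<Rightarrow> 'r) \<Rightarrow> 'r) \<Rightarrow> 'r) \<Rightarrow> 'r) \<Rightarrow> ('x \<Rightarrow> 'r) \<Rightarrow> 'r" where
  "\<mu> k R X = ext k R (\<V> k R X) X (id_hom (\<V> k R X))"

end

(* All the posets of functions involved (continuous maps to R, valuations, minimal valuations) have
   pointwise directed suprema, so Scott continuity of a map into them can be checked at one argument
   at a time, and the monad and strength laws reduce to evaluating both sides at a continuous map.
   The remaining issue is that Kleisli extension and strength preserve minimality. Extension by f is
   Scott-continuous, so only elementary valuations sum r_i delta(x_i) matter; they are sent to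
   sum r_i f(x_i), and minimal valuations are closed under sums and scalar multiples. The latter is
   where commutativity of R enters: it makes a * nu homogeneous. The strength at (x, nu) is the image
   of nu under y |-> (x, y), hence minimal if nu is. *)
theory Submission
  imports Defs
begin


section \<open>Scott-continuous maps\<close>

text \<open>That directed suprema are pointwise is not automatic: a least upper bound taken inside a
  set \<open>C\<close> of functions can differ from the pointwise supremum if the latter falls
  outside \<open>C\<close>. The predicate \<open>lub_closed\<close> excludes this. It holds for
  continuous maps because two suprema can be interchanged, for valuations because homogeneity and
  additivity pass to suprema by continuity of the operations of R, and for minimal valuations
  because the inductive closure is formed with the suprema of all valuations. To show that a
  construction preserves minimality, it is regarded as a Scott-continuous map on all valuations,
  where continuity can be proved without knowing that minimality is preserved. This handles one
  argument at a time, so sums take two rounds. The strength has two arguments; its joint continuity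
  comes from separate continuity, which suffices for Scott continuity on a product order. All finite
  sums are therefore nonempty, and inductions over their length start at 1.\<close>

lemma is_lub_iff:
  assumes "D \<subseteq> carrier P"
  shows "is_lub P s D \<longleftrightarrow> s \<in> carrier P \<and> (\<forall>x\<in>D. x \<sqsubseteq>\<^bsub>P\<^esub> s) \<and>
    (\<forall>u\<in>carrier P. (\<forall>x\<in>D. x \<sqsubseteq>\<^bsub>P\<^esub> u) \<longrightarrow> s \<sqsubseteq>\<^bsub>P\<^esub> u)"
  using assms unfolding least_def Upper_def by blast

lemma directed_subset: "directed P D \<Longrightarrow> D \<subseteq> carrier P"
  by (simp add: directed_def)

lemma directed_upper: "directed P D \<Longrightarrow> x \<in> D \<Longrightarrow> y \<in> D \<Longrightarrow> \<exists>z\<in>D. x \<sqsubseteq>\<^bsub>P\<^esub> z \<and> y \<sqsubseteq>\<^bsub>P\<^esub> z"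
  by (simp add: directed_def)

lemma directed_image:
  assumes "directed P D" "f \<in> carrier P \<rightarrow> carrier Q"
    and "\<And>x y. x \<in> carrier P \<Longrightarrow> y \<in> carrier P \<Longrightarrow> x \<sqsubseteq>\<^bsub>P\<^esub> y \<Longrightarrow> f x \<sqsubseteq>\<^bsub>Q\<^esub> f y"
  shows "directed Q (f ` D)"
proof -
  have D: "D \<subseteq> carrier P" "D \<noteq> {}" "\<And>x y. x \<in> D \<Longrightarrow> y \<in> D \<Longrightarrow> \<exists>z\<in>D. x \<sqsubseteq>\<^bsub>P\<^esub> z \<and> y \<sqsubseteq>\<^bsub>P\<^esub> z"
    using assms(1) by (auto simp: directed_def)
  show ?thesis unfolding directed_def
  proof (intro conjI ballI)
    show "f ` D \<subseteq> carrier Q" "f ` D \<noteq> {}" using D assms(2) by auto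
  next
    fix a b assume "a \<in> f ` D" "b \<in> f ` D"
    then obtain x y where xy: "x \<in> D" "a = f x" "y \<in> D" "b = f y" by blast
    then obtain z where "z \<in> D" "x \<sqsubseteq>\<^bsub>P\<^esub> z" "y \<sqsubseteq>\<^bsub>P\<^esub> z" using D(3) by blast
    with xy D(1) show "\<exists>c\<in>f ` D. a \<sqsubseteq>\<^bsub>Q\<^esub> c \<and> b \<sqsubseteq>\<^bsub>Q\<^esub> c"
      using assms(3) by blast
  qed
qed

text \<open>Once \<open>f\<close> is monotone, \<open>f s\<close> bounds the image of
  \<open>D\<close> from above, so only its comparison with another upper bound \<open>u\<close> is
  left.\<close>

lemma scott_continuousI:
  assumes "\<And>x. x \<in> carrier P \<Longrightarrow> f x \<in> carrier Q"
    and "\<And>x y. x \<in> carrier P \<Longrightarrow> y \<in> carrier P \<Longrightarrow> x \<sqsubseteq>\<^bsub>P\<^esub> y \<Longrightarrow> f x \<sqsubseteq>\<^bsub>Q\<^esub> f y"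
    and "\<And>D s u. directed P D \<Longrightarrow> is_lub P s D \<Longrightarrow> s \<in> carrier P \<Longrightarrow> u \<in> carrier Q \<Longrightarrow>
      (\<And>x. x \<in> D \<Longrightarrow> f x \<sqsubseteq>\<^bsub>Q\<^esub> u) \<Longrightarrow> f s \<sqsubseteq>\<^bsub>Q\<^esub> u"
  shows "scott_continuous P Q f"
  unfolding scott_continuous_def
proof (intro conjI ballI allI impI)
  show "f \<in> carrier P \<rightarrow> carrier Q" using assms(1) by blast
next
  fix D s assume *: "directed P D \<and> is_lub P s D"
  then have D: "D \<subseteq> carrier P" by (simp add: directed_subset)
  then have fD: "f ` D \<subseteq> carrier Q" using assms(1) by blast
  have s: "s \<in> carrier P" "\<forall>x\<in>D. x \<sqsubseteq>\<^bsub>P\<^esub> s"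
    using * by (simp_all add: is_lub_iff[OF D])
  show "is_lub Q (f s) (f ` D)"
    unfolding is_lub_iff[OF fD]
  proof (intro conjI ballI impI)
    show "f s \<in> carrier Q" using assms(1) s(1) .
    show "y \<sqsubseteq>\<^bsub>Q\<^esub> f s" if "y \<in> f ` D" for y using that assms(2) s D by blast
    show "f s \<sqsubseteq>\<^bsub>Q\<^esub> u" if "u \<in> carrier Q" "\<forall>y\<in>f ` D. y \<sqsubseteq>\<^bsub>Q\<^esub> u" for u
      using assms(3)[of D s u] * s(1) that by simp
  qed
qed (use assms(2) in blast)

lemma scott_continuous_in: "scott_continuous P Q f \<Longrightarrow> x \<in> carrier P \<Longrightarrow> f x \<in> carrier Q"
  by (auto simp: scott_continuous_def)

lemma scott_continuous_mono:
  "scott_continuous P Q f \<Longrightarrow> x \<in> carrier P \<Longrightarrow> y \<in> carrier P \<Longrightarrow> x \<sqsubseteq>\<^bsub>P\<^esub> y \<Longrightarrow> f x \<sqsubseteq>\<^bsub>Q\<^esub> f y"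
  by (simp add: scott_continuous_def)

lemma scott_continuous_lub:
  "scott_continuous P Q f \<Longrightarrow> directed P D \<Longrightarrow> is_lub P s D \<Longrightarrow> is_lub Q (f s) (f ` D)"
  unfolding scott_continuous_def by (elim conjE allE impE) (rule conjI)

lemma scott_continuous_directed:
  assumes "scott_continuous P Q f" "directed P D"
  shows "directed Q (f ` D)"
  using assms(2) by (rule directed_image)
    (use scott_continuous_in[OF assms(1)] scott_continuous_mono[OF assms(1)] in auto)

lemma scott_continuous_lub_le:
  assumes "scott_continuous P Q f" "directed P D" "is_lub P s D" "u \<in> carrier Q"
    and "\<And>x. x \<in> D \<Longrightarrow> f x \<sqsubseteq>\<^bsub>Q\<^esub> u"
  shows "f s \<sqsubseteq>\<^bsub>Q\<^esub> u"
proof -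
  have "f ` D \<subseteq> carrier Q"
    using scott_continuous_directed[OF assms(1,2)] by (rule directed_subset)
  with scott_continuous_lub[OF assms(1-3)] assms(4,5) show ?thesis
    by (simp add: is_lub_iff)
qed

lemma scott_continuous_compose:
  assumes f: "scott_continuous P Q f" and g: "scott_continuous Q S g"
  shows "scott_continuous P S (\<lambda>x. g (f x))"
proof (rule scott_continuousI)
  fix D s u
  assume D: "directed P D" and s: "is_lub P s D" and u: "u \<in> carrier S"
    and *: "\<And>x. x \<in> D \<Longrightarrow> g (f x) \<sqsubseteq>\<^bsub>S\<^esub> u"
  show "g (f s) \<sqsubseteq>\<^bsub>S\<^esub> u"
    using g scott_continuous_directed[OF f D] scott_continuous_lub[OF f D s] u
    by (rule scott_continuous_lub_le) (use * in auto)
qed (use scott_continuous_in[OF f] scott_continuous_in[OF g]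
    scott_continuous_mono[OF f] scott_continuous_mono[OF g] in auto)

text \<open>Directed sets and their lubs lie in the carrier, so values elsewhere are invisible. This
  mediates between a map and its \<open>restrict\<close>, the form demanded of morphisms.\<close>

lemma scott_continuous_cong:
  assumes "\<And>x. x \<in> carrier P \<Longrightarrow> f x = g x"
  shows "scott_continuous P Q f \<longleftrightarrow> scott_continuous P Q g"
proof -
  have "scott_continuous P Q g'" if "scott_continuous P Q f'"
    and eq: "\<And>x. x \<in> carrier P \<Longrightarrow> f' x = g' x" for f' g'
  proof (rule scott_continuousI)
    fix D s u
    assume D: "directed P D" and s: "is_lub P s D" "s \<in> carrier P" and u: "u \<in> carrier Q"
      and *: "\<And>x. x \<in> D \<Longrightarrow> g' x \<sqsubseteq>\<^bsub>Q\<^esub> u"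
    have "f' s \<sqsubseteq>\<^bsub>Q\<^esub> u"
      using that(1) D s(1) u by (rule scott_continuous_lub_le) (use * eq directed_subset[OF D] in auto)
    with eq s(2) show "g' s \<sqsubseteq>\<^bsub>Q\<^esub> u" by simp
  qed (use scott_continuous_in[OF that(1)] scott_continuous_mono[OF that(1)] eq in auto)
  with assms show ?thesis by metis
qed

lemma scott_continuous_id: "scott_continuous P P (\<lambda>x. x)"
  by (simp add: scott_continuous_def)

section \<open>Binary products of posets\<close>

lemma carrier_prod_dcpo [simp]: "carrier (P \<otimes>\<^sub>d Q) = carrier P \<times> carrier Q"
  by (simp add: prod_dcpo_def)

lemma le_prod_dcpo [simp]:
  "p \<sqsubseteq>\<^bsub>P \<otimes>\<^sub>d Q\<^esub> q \<longleftrightarrow> fst p \<sqsubseteq>\<^bsub>P\<^esub> fst q \<and> snd p \<sqsubseteq>\<^bsub>Q\<^esub> snd q"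
  by (simp add: prod_dcpo_def)

lemma scott_continuous_fst: "scott_continuous (P \<otimes>\<^sub>d Q) P fst"
proof (rule scott_continuousI)
  fix D s u
  assume D: "directed (P \<otimes>\<^sub>d Q) D" and s: "is_lub (P \<otimes>\<^sub>d Q) s D" and u: "u \<in> carrier P"
    and *: "\<And>x. x \<in> D \<Longrightarrow> fst x \<sqsubseteq>\<^bsub>P\<^esub> u"
  \<comment> \<open>Replacing only the first component of the lub by \<open>u\<close> still gives an
    upper bound of \<open>D\<close>; leastness of \<open>s\<close> then compares the first
    components.\<close>
  have "(u, snd s) \<in> carrier (P \<otimes>\<^sub>d Q)" "\<forall>x\<in>D. x \<sqsubseteq>\<^bsub>P \<otimes>\<^sub>d Q\<^esub> (u, snd s)"
    using s u * by (auto simp: is_lub_iff[OF directed_subset[OF D]])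
  with s show "fst s \<sqsubseteq>\<^bsub>P\<^esub> u"
    unfolding is_lub_iff[OF directed_subset[OF D]] by fastforce
qed auto

lemma scott_continuous_snd: "scott_continuous (P \<otimes>\<^sub>d Q) Q snd"
proof (rule scott_continuousI)
  fix D s u
  assume D: "directed (P \<otimes>\<^sub>d Q) D" and s: "is_lub (P \<otimes>\<^sub>d Q) s D" and u: "u \<in> carrier Q"
    and *: "\<And>x. x \<in> D \<Longrightarrow> snd x \<sqsubseteq>\<^bsub>Q\<^esub> u"
  have "(fst s, u) \<in> carrier (P \<otimes>\<^sub>d Q)" "\<forall>x\<in>D. x \<sqsubseteq>\<^bsub>P \<otimes>\<^sub>d Q\<^esub> (fst s, u)"
    using s u * by (auto simp: is_lub_iff[OF directed_subset[OF D]])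
  with s show "snd s \<sqsubseteq>\<^bsub>Q\<^esub> u"
    unfolding is_lub_iff[OF directed_subset[OF D]] by fastforce
qed auto

lemma scott_continuous_Pair:
  assumes f: "scott_continuous P Q f" and g: "scott_continuous P S g"
  shows "scott_continuous P (Q \<otimes>\<^sub>d S) (\<lambda>x. (f x, g x))"
proof (rule scott_continuousI)
  fix D s u
  assume D: "directed P D" and s: "is_lub P s D" and u: "u \<in> carrier (Q \<otimes>\<^sub>d S)"
    and *: "\<And>x. x \<in> D \<Longrightarrow> (f x, g x) \<sqsubseteq>\<^bsub>Q \<otimes>\<^sub>d S\<^esub> u"
  have "f s \<sqsubseteq>\<^bsub>Q\<^esub> fst u" using f D s by (rule scott_continuous_lub_le) (use u * in auto)
  moreover have "g s \<sqsubseteq>\<^bsub>S\<^esub> snd u" using g D s by (rule scott_continuous_lub_le) (use u * in auto)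
  ultimately show "(f s, g s) \<sqsubseteq>\<^bsub>Q \<otimes>\<^sub>d S\<^esub> u" by simp
qed (use scott_continuous_in[OF f] scott_continuous_in[OF g]
    scott_continuous_mono[OF f] scott_continuous_mono[OF g] in auto)

lemma partial_order_refl: "partial_order P \<Longrightarrow> x \<in> carrier P \<Longrightarrow> x \<sqsubseteq>\<^bsub>P\<^esub> x"
  by (simp add: partial_order_def weak_partial_order.le_refl)

text \<open>A directed set is nonempty, so a bound on the image really bounds
  \<open>c\<close>.\<close>

lemma scott_continuous_const:
  assumes "partial_order Q" "c \<in> carrier Q"
  shows "scott_continuous P Q (\<lambda>x. c)"
proof (rule scott_continuousI)
  fix D s u
  assume "directed P D" "\<And>x. x \<in> D \<Longrightarrow> c \<sqsubseteq>\<^bsub>Q\<^esub> u"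
  then show "c \<sqsubseteq>\<^bsub>Q\<^esub> u" by (auto simp: directed_def)
qed (use assms partial_order_refl in auto)

lemma partial_orderI:
  assumes "eq P = (=)" "\<And>x. x \<in> carrier P \<Longrightarrow> x \<sqsubseteq>\<^bsub>P\<^esub> x"
    and "\<And>x y. x \<sqsubseteq>\<^bsub>P\<^esub> y \<Longrightarrow> y \<sqsubseteq>\<^bsub>P\<^esub> x \<Longrightarrow> x \<in> carrier P \<Longrightarrow> y \<in> carrier P \<Longrightarrow> x = y"
    and "\<And>x y z. x \<sqsubseteq>\<^bsub>P\<^esub> y \<Longrightarrow> y \<sqsubseteq>\<^bsub>P\<^esub> z \<Longrightarrow> x \<in> carrier P \<Longrightarrow> y \<in> carrier P \<Longrightarrow> z \<in> carrier P \<Longrightarrow> x \<sqsubseteq>\<^bsub>P\<^esub> z"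
  shows "partial_order P"
proof -
  interpret equivalence P by unfold_locales (simp_all add: assms(1))
  show ?thesis by unfold_locales (use assms in \<open>auto\<close>)
qed

lemma partial_order_prod:
  assumes "partial_order P" "partial_order Q"
  shows "partial_order (P \<otimes>\<^sub>d Q)"
proof -
  interpret P: partial_order P by fact
  interpret Q: partial_order Q by fact
  show ?thesis
    by (rule partial_orderI)
      (auto simp: prod_dcpo_def intro: P.le_antisym Q.le_antisym P.le_trans Q.le_trans)
qed

lemma partial_order_one: "partial_order one_dcpo"
  by (rule partial_orderI) (auto simp: one_dcpo_def)

text \<open>Lubs in the product are componentwise, and by directedness a bound of \<open>f\<close>
  on \<open>D\<close> is a bound on the whole rectangle spanned by the two projections of
  \<open>D\<close>. The lub can therefore be taken in one coordinate and then in the other.\<close>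

lemma scott_continuous_separately:
  assumes S: "partial_order S"
    and "\<And>x. x \<in> carrier P \<Longrightarrow> scott_continuous Q S (\<lambda>y. f (x, y))"
    and "\<And>y. y \<in> carrier Q \<Longrightarrow> scott_continuous P S (\<lambda>x. f (x, y))"
  shows "scott_continuous (P \<otimes>\<^sub>d Q) S f"
proof -
  interpret S: partial_order S by fact
  have cl: "f (x, y) \<in> carrier S" if "x \<in> carrier P" "y \<in> carrier Q" for x y
    using scott_continuous_in[OF assms(2)[OF that(1)] that(2)] .
  have mono: "f (x, y) \<sqsubseteq>\<^bsub>S\<^esub> f (x', y')"
    if "x \<in> carrier P" "y \<in> carrier Q" "x' \<in> carrier P" "y' \<in> carrier Q" "x \<sqsubseteq>\<^bsub>P\<^esub> x'" "y \<sqsubseteq>\<^bsub>Q\<^esub> y'"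
    for x y x' y'
  proof (rule S.le_trans)
    show "f (x, y) \<sqsubseteq>\<^bsub>S\<^esub> f (x, y')"
      using scott_continuous_mono[OF assms(2)[OF that(1)] that(2,4,6)] .
    show "f (x, y') \<sqsubseteq>\<^bsub>S\<^esub> f (x', y')"
      using scott_continuous_mono[OF assms(3)[OF that(4)] that(1,3,5)] .
  qed (use that cl in auto)
  show ?thesis
  proof (rule scott_continuousI)
    fix D s u
    assume D: "directed (P \<otimes>\<^sub>d Q) D" and s: "is_lub (P \<otimes>\<^sub>d Q) s D" "s \<in> carrier (P \<otimes>\<^sub>d Q)"
      and u: "u \<in> carrier S" and *: "\<And>p. p \<in> D \<Longrightarrow> f p \<sqsubseteq>\<^bsub>S\<^esub> u"
    have D1: "directed P (fst ` D)" "is_lub P (fst s) (fst ` D)"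
      using scott_continuous_directed[OF scott_continuous_fst D]
        scott_continuous_lub[OF scott_continuous_fst D s(1)] .
    have D2: "directed Q (snd ` D)" "is_lub Q (snd s) (snd ` D)"
      using scott_continuous_directed[OF scott_continuous_snd D]
        scott_continuous_lub[OF scott_continuous_snd D s(1)] .
    \<comment> \<open>The mixed pair \<open>(fst p, snd q)\<close> need not lie in \<open>D\<close>,
      but it is below a common upper bound \<open>r\<close> of \<open>p\<close> and \<open>q\<close>
      in \<open>D\<close>.\<close>
    have "f (fst p, snd q) \<sqsubseteq>\<^bsub>S\<^esub> u" if p: "p \<in> D" and q: "q \<in> D" for p q
    proof -
      obtain r where r: "r \<in> D" "p \<sqsubseteq>\<^bsub>P \<otimes>\<^sub>d Q\<^esub> r" "q \<sqsubseteq>\<^bsub>P \<otimes>\<^sub>d Q\<^esub> r"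
        using directed_upper[OF D p q] by blast
      moreover have "p \<in> carrier (P \<otimes>\<^sub>d Q)" "q \<in> carrier (P \<otimes>\<^sub>d Q)" "r \<in> carrier (P \<otimes>\<^sub>d Q)"
        using directed_subset[OF D] p q r(1) by blast+
      ultimately have "f (fst p, snd q) \<sqsubseteq>\<^bsub>S\<^esub> f r" "f r \<in> carrier S" "f (fst p, snd q) \<in> carrier S"
        using mono[of "fst p" "snd q" "fst r" "snd r"] cl[of "fst r" "snd r"] cl[of "fst p" "snd q"]
        by (auto simp: mem_Times_iff)
      with *[OF r(1)] u show ?thesis using S.le_trans by blast
    qed
    then have "f (x, snd s) \<sqsubseteq>\<^bsub>S\<^esub> u" if "x \<in> fst ` D" for x
      using that directed_subset[OF D1(1)]
      by (intro scott_continuous_lub_le[OF assms(2) D2 u]) force+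
    then have "f (fst s, snd s) \<sqsubseteq>\<^bsub>S\<^esub> u"
      using s(2) by (intro scott_continuous_lub_le[OF assms(3) D1 u]) auto
    then show "f s \<sqsubseteq>\<^bsub>S\<^esub> u" by simp
  qed (use cl mono in auto)
qed


section \<open>Pointwise orders\<close>

lemma carrier_order_poset [simp]: "carrier order_poset = UNIV"
  by (simp add: order_poset_def)

lemma le_order_poset [simp]: "x \<sqsubseteq>\<^bsub>order_poset\<^esub> y \<longleftrightarrow> x \<le> y"
  by (simp add: order_poset_def)

lemma is_lub_order_poset:
  "is_lub order_poset s D \<longleftrightarrow> (\<forall>x\<in>D. x \<le> s) \<and> (\<forall>u. (\<forall>x\<in>D. x \<le> u) \<longrightarrow> s \<le> u)"
  by (simp add: is_lub_iff)

lemma is_lub_order_poset_unique: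
  "is_lub order_poset s D \<Longrightarrow> is_lub order_poset t D \<Longrightarrow> s = t"
  by (simp add: is_lub_order_poset order.antisym)

lemma partial_order_order_poset: "partial_order order_poset"
  by (rule partial_orderI) (auto simp: order_poset_def)

text \<open>Maps into R are defined topologically; this translates them once and for all into the
  language of directed lubs.\<close>

lemma continuous_map_scott_iff:
  fixes h :: "'x \<Rightarrow> 'r::order"
  shows "continuous_map (scott X) (scott order_poset) h \<longleftrightarrow> scott_continuous X order_poset h"
proof
  assume h: "scott_continuous X order_poset h"
  have "scott_open X {x \<in> carrier X. h x \<in> U}" if U: "scott_open order_poset U" for U
    unfolding scott_open_def
  proof (intro conjI ballI allI impI)
    fix x y assume "x \<in> {x \<in> carrier X. h x \<in> U}" "y \<in> carrier X" "x \<sqsubseteq>\<^bsub>X\<^esub> y"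
    then show "y \<in> {x \<in> carrier X. h x \<in> U}"
      using U scott_continuous_mono[OF h, of x y] by (auto simp: scott_open_def)
  next
    fix D s assume *: "directed X D \<and> is_lub X s D \<and> s \<in> {x \<in> carrier X. h x \<in> U}"
    then have "h ` D \<inter> U \<noteq> {}"
      using scott_open_directed[OF U] scott_continuous_directed[OF h] scott_continuous_lub[OF h] by blast
    then show "D \<inter> {x \<in> carrier X. h x \<in> U} \<noteq> {}"
      using * directed_subset by blast
  qed auto
  then show "continuous_map (scott X) (scott order_poset) h"
    by (simp add: continuous_map_def topspace_scott openin_scott)
next
  assume h: "continuous_map (scott X) (scott order_poset) h"
  \<comment> \<open>Complements of principal down-sets are Scott open. Their preimages detect both
    monotonicity (with \<open>u\<close> set to \<open>h y\<close>) and preservation of lubs.\<close>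
  have "scott_open order_poset {r. \<not> r \<le> u}" for u :: 'r
    by (auto simp: scott_open_def is_lub_order_poset dest: order.trans)
  then have op: "scott_open X {x \<in> carrier X. \<not> h x \<le> u}" for u
    using h by (force simp: continuous_map_def topspace_scott openin_scott)
  show "scott_continuous X order_poset h"
  proof (rule scott_continuousI)
    fix x y assume "x \<in> carrier X" "y \<in> carrier X" "x \<sqsubseteq>\<^bsub>X\<^esub> y"
    then show "h x \<sqsubseteq>\<^bsub>order_poset\<^esub> h y"
      using op[of "h y"] by (force simp: scott_open_def)
  next
    fix D s u assume "directed X D" "is_lub X s D" "s \<in> carrier X"
      "\<And>x. x \<in> D \<Longrightarrow> h x \<sqsubseteq>\<^bsub>order_poset\<^esub> u"
    then show "h s \<sqsubseteq>\<^bsub>order_poset\<^esub> u"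
      using scott_open_directed[OF op[of u]] by fastforce
  qed simp
qed

text \<open>\<open>A\<close> is where functions are compared, \<open>C\<close> is the carrier.
  Continuous maps, valuations and minimal valuations all have this shape, the last two with the
  continuous maps as \<open>A\<close>.\<close>

definition pointwise :: "'a set \<Rightarrow> ('a \<Rightarrow> 'r::order) set \<Rightarrow> ('a \<Rightarrow> 'r) gorder" where
  "pointwise A C = \<lparr>carrier = C, eq = (=), le = (\<lambda>f g. \<forall>x\<in>A. f x \<le> g x)\<rparr>"

text \<open>No carrier occurs here, so the candidate for a lub can be named before it is known to
  belong to one. Extensionality makes it unique.\<close>

definition pointwise_lub :: "'a set \<Rightarrow> ('a \<Rightarrow> 'r::order) set \<Rightarrow> ('a \<Rightarrow> 'r) \<Rightarrow> bool" where
  "pointwise_lub A D s \<longleftrightarrow>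
     s \<in> extensional A \<and> (\<forall>x\<in>A. is_lub order_poset (s x) ((\<lambda>f. f x) ` D))"

definition lub_closed :: "'a set \<Rightarrow> ('a \<Rightarrow> 'r::order) set \<Rightarrow> bool" where
  "lub_closed A C \<longleftrightarrow> C \<subseteq> extensional A \<and>
     (\<forall>D s. directed (pointwise A C) D \<longrightarrow> pointwise_lub A D s \<longrightarrow> s \<in> C)"

lemma carrier_pointwise [simp]: "carrier (pointwise A C) = C"
  by (simp add: pointwise_def)

lemma le_pointwise [simp]: "f \<sqsubseteq>\<^bsub>pointwise A C\<^esub> g \<longleftrightarrow> (\<forall>x\<in>A. f x \<le> g x)"
  by (simp add: pointwise_def)

lemma partial_order_pointwise:
  assumes "C \<subseteq> extensional A"
  shows "partial_order (pointwise A C)"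
proof (rule partial_orderI)
  fix f g assume "f \<sqsubseteq>\<^bsub>pointwise A C\<^esub> g" "g \<sqsubseteq>\<^bsub>pointwise A C\<^esub> f"
    "f \<in> carrier (pointwise A C)" "g \<in> carrier (pointwise A C)"
  then show "f = g" using assms by (intro extensionalityI[of f A g] order.antisym) auto
qed (auto simp: pointwise_def dest: order.trans)

lemma directed_pointwise_change:
  "directed (pointwise A C) D \<Longrightarrow> D \<subseteq> C' \<Longrightarrow> directed (pointwise A C') D"
  by (simp add: directed_def)

lemma pointwise_directed_at:
  "directed (pointwise A C) D \<Longrightarrow> x \<in> A \<Longrightarrow> directed order_poset ((\<lambda>f. f x) ` D)"
  by (rule directed_image) auto

lemma pointwise_lub_exists:
  fixes D :: "('a \<Rightarrow> 'r::d_rag) set"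
  assumes "directed (pointwise A C) D"
  shows "\<exists>s. pointwise_lub A D s"
proof -
  have "\<forall>x\<in>A. \<exists>r::'r. is_lub order_poset r ((\<lambda>f. f x) ` D)"
    using pointwise_directed_at[OF assms] dcpo_order_poset unfolding dcpo_def by blast
  then obtain s where "\<forall>x\<in>A. is_lub order_poset (s x :: 'r) ((\<lambda>f. f x) ` D)"
    by metis
  then have "pointwise_lub A D (restrict s A)"
    by (simp add: pointwise_lub_def)
  then show ?thesis by blast
qed

lemma pointwise_lub_is_lub:
  assumes "D \<subseteq> C" "pointwise_lub A D s" "s \<in> C"
  shows "is_lub (pointwise A C) s D"
  using assms by (simp add: is_lub_iff pointwise_lub_def is_lub_order_poset)

text \<open>A pointwise lub exists since R is a dcpo, \<open>lub_closed\<close> puts it into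
  \<open>C\<close>, and antisymmetry leaves no other lub.\<close>

lemma is_lub_pointwise_iff:
  fixes C :: "('a \<Rightarrow> 'r::d_rag) set"
  assumes C: "lub_closed A C" and D: "directed (pointwise A C) D"
  shows "is_lub (pointwise A C) s D \<longleftrightarrow> pointwise_lub A D s"
proof -
  have DC: "D \<subseteq> C" using directed_subset[OF D] by simp
  obtain t where t: "pointwise_lub A D t" using pointwise_lub_exists[OF D] by blast
  have lub: "is_lub (pointwise A C) s' D" if "pointwise_lub A D s'" for s'
    using C D DC that pointwise_lub_is_lub unfolding lub_closed_def by blast
  interpret partial_order "pointwise A C"
    using C by (intro partial_order_pointwise) (simp add: lub_closed_def)
  have "s = t" if "is_lub (pointwise A C) s D"
    using least_unique that lub[OF t] by blast
  with lub t show ?thesis by blast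
qed

lemma dcpo_pointwise:
  fixes C :: "('a \<Rightarrow> 'r::d_rag) set"
  assumes C: "lub_closed A C"
  shows "dcpo (pointwise A C)"
  unfolding dcpo_def
proof (intro conjI allI impI)
  show "partial_order (pointwise A C)"
    using C by (intro partial_order_pointwise) (simp add: lub_closed_def)
  fix D assume D: "directed (pointwise A C) D"
  show "\<exists>s. is_lub (pointwise A C) s D"
    using pointwise_lub_exists[OF D] is_lub_pointwise_iff[OF C D] by blast
qed

text \<open>From left to right, lubs in \<open>C\<close> are pointwise; from right to left,
  \<open>f s\<close> is compared with an upper bound at each argument.\<close>

lemma scott_continuous_pointwise_iff:
  fixes C :: "('a \<Rightarrow> 'r::d_rag) set"
  assumes C: "lub_closed A C" and f: "\<And>x. x \<in> carrier P \<Longrightarrow> f x \<in> C"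
  shows "scott_continuous P (pointwise A C) f \<longleftrightarrow>
    (\<forall>a\<in>A. scott_continuous P order_poset (\<lambda>x. f x a))"
proof (intro iffI ballI)
  fix a assume cont: "scott_continuous P (pointwise A C) f" and a: "a \<in> A"
  show "scott_continuous P order_poset (\<lambda>x. f x a)"
  proof (rule scott_continuousI)
    fix D s u assume D: "directed P D" "is_lub P s D"
      and u: "\<And>x. x \<in> D \<Longrightarrow> f x a \<sqsubseteq>\<^bsub>order_poset\<^esub> u"
    have "pointwise_lub A (f ` D) (f s)"
      using is_lub_pointwise_iff[OF C scott_continuous_directed[OF cont D(1)]]
        scott_continuous_lub[OF cont D] by blast
    then show "f s a \<sqsubseteq>\<^bsub>order_poset\<^esub> u"
      using a u by (simp add: pointwise_lub_def is_lub_order_poset)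
  qed (use scott_continuous_mono[OF cont] a in auto)
next
  assume cont: "\<forall>a\<in>A. scott_continuous P order_poset (\<lambda>x. f x a)"
  show "scott_continuous P (pointwise A C) f"
  proof (rule scott_continuousI)
    fix D s u assume D: "directed P D" "is_lub P s D"
      and u: "\<And>x. x \<in> D \<Longrightarrow> f x \<sqsubseteq>\<^bsub>pointwise A C\<^esub> u"
    show "f s \<sqsubseteq>\<^bsub>pointwise A C\<^esub> u"
      using cont scott_continuous_lub_le[OF _ D, of order_poset "\<lambda>x. f x _" "u _"] u by simp
  qed (use f cont scott_continuous_mono in fastforce)+
qed

lemma scott_continuous_eval:
  fixes C :: "('a \<Rightarrow> 'r::d_rag) set"
  assumes "lub_closed A C" "a \<in> A"
  shows "scott_continuous (pointwise A C) order_poset (\<lambda>f. f a)"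
  using scott_continuous_pointwise_iff[OF assms(1), of "pointwise A C" "\<lambda>f. f"]
    scott_continuous_id assms(2) by auto


section \<open>Continuous functions into the d-rag\<close>

abbreviation cmaps :: "'r::order itself \<Rightarrow> 'x gorder \<Rightarrow> ('x \<Rightarrow> 'r) set" where
  "cmaps R X \<equiv> carrier (cont_maps R (scott X))"

lemma cmaps_iff:
  "h \<in> cmaps R X \<longleftrightarrow> h \<in> extensional (carrier X) \<and> scott_continuous X order_poset h"
  by (simp add: cont_maps_def topspace_scott continuous_map_scott_iff)

lemma cont_maps_eq: "cont_maps R (scott X) = pointwise (carrier X) (cmaps R X)"
  by (simp add: cont_maps_def pointwise_def topspace_scott)

lemma restrict_cmaps: "scott_continuous X order_poset h \<Longrightarrow> restrict h (carrier X) \<in> cmaps R X"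
  using scott_continuous_cong[of X "restrict h (carrier X)" h] by (simp add: cmaps_iff)

text \<open>Two suprema are interchanged: a bound \<open>u\<close> of \<open>s\<close> on the
  directed set \<open>E\<close> bounds each \<open>f\<close> in \<open>D\<close> on
  \<open>E\<close>, hence \<open>f t\<close> by continuity of \<open>f\<close>, hence
  \<open>s t\<close>. As \<open>X\<close> is arbitrary, the lemma serves again for valuations, whose
  domain is a poset of maps.\<close>

lemma scott_continuous_pointwise_lub:
  assumes lub: "pointwise_lub (carrier X) D s"
    and cont: "\<And>f. f \<in> D \<Longrightarrow> scott_continuous X order_poset f"
  shows "scott_continuous X order_poset s"
proof (rule scott_continuousI)
  fix x y assume xy: "x \<in> carrier X" "y \<in> carrier X" "x \<sqsubseteq>\<^bsub>X\<^esub> y"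
  have "f x \<le> s y" if "f \<in> D" for f
  proof (rule order.trans)
    show "f x \<le> f y" using scott_continuous_mono[OF cont[OF that] xy] by simp
    show "f y \<le> s y" using lub that xy(2) by (simp add: pointwise_lub_def is_lub_order_poset)
  qed
  then show "s x \<sqsubseteq>\<^bsub>order_poset\<^esub> s y"
    using lub xy(1) by (simp add: pointwise_lub_def is_lub_order_poset)
next
  fix E t u assume E: "directed X E" "is_lub X t E" and t: "t \<in> carrier X"
    and u: "\<And>x. x \<in> E \<Longrightarrow> s x \<sqsubseteq>\<^bsub>order_poset\<^esub> u"
  have "f t \<le> u" if "f \<in> D" for f
  proof -
    have "f x \<le> u" if "x \<in> E" for x
    proof (rule order.trans)
      have "x \<in> carrier X" using directed_subset[OF E(1)] that by blast
      then show "f x \<le> s x"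
        using lub \<open>f \<in> D\<close> by (simp add: pointwise_lub_def is_lub_order_poset)
      show "s x \<le> u" using u[OF that] by simp
    qed
    then show ?thesis
      using scott_continuous_lub_le[OF cont[OF that] E, of u] by simp
  qed
  then show "s t \<sqsubseteq>\<^bsub>order_poset\<^esub> u"
    using lub t by (simp add: pointwise_lub_def is_lub_order_poset)
qed simp

lemma lub_closed_cmaps: "lub_closed (carrier X) (cmaps R X)"
  unfolding lub_closed_def
proof (intro conjI allI impI)
  show "cmaps R X \<subseteq> extensional (carrier X)" by (auto simp: cmaps_iff)
  fix D s assume "directed (pointwise (carrier X) (cmaps R X)) D" "pointwise_lub (carrier X) D s"
  then show "s \<in> cmaps R X"
    using scott_continuous_pointwise_lub[of X D s] directed_subset
    by (fastforce simp: cmaps_iff pointwise_lub_def)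
qed

text \<open>Currying: continuity in each variable makes the transposed map continuous into the
  function space.\<close>

lemma scott_continuous_cmaps:
  fixes R :: "'r::d_rag itself"
  assumes "\<And>p. p \<in> carrier P \<Longrightarrow> scott_continuous X order_poset (f p :: 'x \<Rightarrow> 'r)"
    and "\<And>x. x \<in> carrier X \<Longrightarrow> scott_continuous P order_poset (\<lambda>p. f p x)"
  shows "scott_continuous P (cont_maps R (scott X)) (\<lambda>p. \<lambda>x\<in>carrier X. f p x)"
  using assms by (subst cont_maps_eq, subst scott_continuous_pointwise_iff[OF lub_closed_cmaps])
    (auto intro: restrict_cmaps)

lemma scott_continuous_cmaps_eval:
  fixes R :: "'r::d_rag itself"
  shows "x \<in> carrier X \<Longrightarrow> scott_continuous (cont_maps R (scott X)) order_poset (\<lambda>h. h x)"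
  by (rule scott_continuous_eval[OF lub_closed_cmaps, folded cont_maps_eq])

lemma scott_continuous_add:
  fixes f g :: "'x \<Rightarrow> 'r::d_rag"
  assumes "scott_continuous P order_poset f" "scott_continuous P order_poset g"
  shows "scott_continuous P order_poset (\<lambda>x. f x + g x)"
  using scott_continuous_compose[OF scott_continuous_Pair[OF assms] scott_continuous_plus] by simp

lemma scott_continuous_mult:
  fixes f g :: "'x \<Rightarrow> 'r::d_rag"
  assumes "scott_continuous P order_poset f" "scott_continuous P order_poset g"
  shows "scott_continuous P order_poset (\<lambda>x. f x * g x)"
  using scott_continuous_compose[OF scott_continuous_Pair[OF assms] scott_continuous_times] by simp

lemma scott_continuous_const_order_poset: "scott_continuous P order_poset (\<lambda>x. c)"
  by (rule scott_continuous_const[OF partial_order_order_poset]) simp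

lemmas scott_continuous_cmult =
  scott_continuous_mult[OF scott_continuous_const_order_poset]


section \<open>Continuous valuations\<close>

lemma cmaps_scale: "h \<in> cmaps R X \<Longrightarrow> (\<lambda>x\<in>carrier X. a * h x) \<in> cmaps R X"
  for R :: "'r::d_rag itself"
  by (rule restrict_cmaps) (simp add: cmaps_iff scott_continuous_cmult)

lemma cmaps_add: "h \<in> cmaps R X \<Longrightarrow> h' \<in> cmaps R X \<Longrightarrow> (\<lambda>x\<in>carrier X. h x + h' x) \<in> cmaps R X"
  for R :: "'r::d_rag itself"
  by (rule restrict_cmaps) (simp add: cmaps_iff scott_continuous_add)

lemma valuation_iff:
  "\<nu> \<in> carrier (valuations R (scott X)) \<longleftrightarrow> \<nu> \<in> extensional (cmaps R X) \<and>
     scott_continuous (cont_maps R (scott X)) order_poset \<nu> \<and>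
     (\<forall>a. \<forall>h\<in>cmaps R X. \<nu> (\<lambda>x\<in>carrier X. a * h x) = a * \<nu> h) \<and>
     (\<forall>h\<in>cmaps R X. \<forall>h'\<in>cmaps R X. \<nu> (\<lambda>x\<in>carrier X. h x + h' x) = \<nu> h + \<nu> h')"
  by (simp add: valuations_def topspace_scott)

lemma valuations_eq:
  "valuations R (scott X) = pointwise (cmaps R X) (carrier (valuations R (scott X)))"
  by (simp add: valuations_def pointwise_def)

text \<open>The pairs \<open>(g y, g z)\<close> form a directed set with lub
  \<open>(s y, s z)\<close>, and \<open>f\<close> preserves that lub. Homogeneity and additivity of
  valuations are both equations of this form, so both survive at directed lubs.\<close>

lemma pointwise_lub_eqI:
  assumes lub: "pointwise_lub A D s" and A: "x \<in> A" "y \<in> A" "z \<in> A"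
    and D: "directed (pointwise A C) D"
    and f: "scott_continuous (order_poset \<otimes>\<^sub>d order_poset) order_poset f"
    and eq: "\<And>g. g \<in> D \<Longrightarrow> g x = f (g y, g z)"
  shows "s x = f (s y, s z)"
proof -
  let ?E = "(\<lambda>g. (g y, g z)) ` D"
  have "directed (order_poset \<otimes>\<^sub>d order_poset) ?E"
    by (rule directed_image[OF D]) (use A in auto)
  moreover have "is_lub (order_poset \<otimes>\<^sub>d order_poset) (s y, s z) ?E"
    using lub A by (subst is_lub_iff) (auto simp: pointwise_lub_def is_lub_order_poset)
  ultimately have "is_lub order_poset (f (s y, s z)) (f ` ?E)"
    by (rule scott_continuous_lub[OF f])
  also have "f ` ?E = (\<lambda>g. g x) ` D"
    using eq by (force simp: image_image)
  finally show ?thesis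
    using lub A by (intro is_lub_order_poset_unique) (simp_all add: pointwise_lub_def)
qed

lemma lub_closed_valuations:
  fixes R :: "'r::d_rag itself"
  shows "lub_closed (cmaps R X) (carrier (valuations R (scott X)))"
  unfolding lub_closed_def
proof (intro conjI allI impI)
  show "carrier (valuations R (scott X)) \<subseteq> extensional (cmaps R X)"
    by (auto simp: valuation_iff)
  fix D s
  assume D: "directed (pointwise (cmaps R X) (carrier (valuations R (scott X)))) D"
    and s: "pointwise_lub (cmaps R X) D s"
  have val: "\<nu> \<in> carrier (valuations R (scott X))" if "\<nu> \<in> D" for \<nu>
    using directed_subset[OF D] that by auto
  show "s \<in> carrier (valuations R (scott X))"
    unfolding valuation_iff
  proof (intro conjI allI ballI)
    show "s \<in> extensional (cmaps R X)" using s by (simp add: pointwise_lub_def)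
    show "scott_continuous (cont_maps R (scott X)) order_poset s"
      using val by (intro scott_continuous_pointwise_lub[OF s]) (simp add: valuation_iff)
  next
    fix a :: 'r and h assume h: "h \<in> cmaps R X"
    \<comment> \<open>Homogeneity has a single operand: the transfer lemma is used with
      \<open>h\<close> in both places and a function that ignores the second.\<close>
    have "scott_continuous (order_poset \<otimes>\<^sub>d order_poset) order_poset (\<lambda>p. a * fst p)"
      by (intro scott_continuous_cmult scott_continuous_fst)
    from pointwise_lub_eqI[OF s cmaps_scale[OF h, of a] h h D this]
    show "s (\<lambda>x\<in>carrier X. a * h x) = a * s h"
      using val h by (simp add: valuation_iff)
  next
    fix h h' assume h: "h \<in> cmaps R X" "h' \<in> cmaps R X"
    from pointwise_lub_eqI[OF s cmaps_add[OF h] h D scott_continuous_plus]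
    show "s (\<lambda>x\<in>carrier X. h x + h' x) = s h + s h'"
      using val h by (simp add: valuation_iff)
  qed
qed

lemma is_lub_valuations_iff:
  "directed (valuations R (scott X)) D \<Longrightarrow>
    is_lub (valuations R (scott X)) s D \<longleftrightarrow> pointwise_lub (cmaps R X) D s"
  by (rule is_lub_pointwise_iff[OF lub_closed_valuations, folded valuations_eq])


section \<open>Minimal valuations\<close>

lemma inductive_closure_base: "B \<subseteq> inductive_closure P B"
  by (auto simp: inductive_closure_def)

lemma inductive_closure_subset:
  assumes "B \<subseteq> carrier P"
  shows "inductive_closure P B \<subseteq> carrier P"
proof -
  have "s \<in> carrier P" if "is_lub P s D" for s D using that by (rule least_closed)
  then show ?thesis using assms unfolding inductive_closure_def by blast
qed

lemma inductive_closure_lub: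
  assumes "directed P D" "D \<subseteq> inductive_closure P B" "is_lub P s D"
  shows "s \<in> inductive_closure P B"
  unfolding inductive_closure_def
proof (rule InterI, clarify)
  fix A assume A: "B \<subseteq> A" "A \<subseteq> carrier P"
    "\<forall>D s. directed P D \<and> D \<subseteq> A \<and> is_lub P s D \<longrightarrow> s \<in> A"
  then have "D \<subseteq> A" using assms(2) unfolding inductive_closure_def by blast
  with A(3) assms(1,3) show "s \<in> A" by simp
qed

lemma inductive_closure_least:
  assumes "B \<subseteq> A" "A \<subseteq> carrier P"
    and "\<And>D s. directed P D \<Longrightarrow> D \<subseteq> A \<Longrightarrow> is_lub P s D \<Longrightarrow> s \<in> A"
  shows "inductive_closure P B \<subseteq> A"
  unfolding inductive_closure_def
proof (intro Inter_lower CollectI conjI allI impI)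
  show "s \<in> A" if "directed P D \<and> D \<subseteq> A \<and> is_lub P s D" for D s
    using that assms(3)[of D s] by simp
qed (fact assms)+

text \<open>The part of the closure that satisfies \<open>Q\<close> contains \<open>B\<close> and is
  closed under directed lubs, so it is the whole closure. Staying inside the closure lets the case
  of lubs assume that \<open>D\<close> lies in it.\<close>

lemma inductive_closure_induct:
  assumes x: "x \<in> inductive_closure P B" and B: "B \<subseteq> carrier P"
    and base: "\<And>b. b \<in> B \<Longrightarrow> Q b"
    and lub: "\<And>D s. directed P D \<Longrightarrow> D \<subseteq> inductive_closure P B \<Longrightarrow> is_lub P s D \<Longrightarrow>
      (\<And>d. d \<in> D \<Longrightarrow> Q d) \<Longrightarrow> Q s"
  shows "Q x"
proof -
  let ?A = "{x \<in> inductive_closure P B. Q x}"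
  have "s \<in> ?A" if D: "directed P D" "D \<subseteq> ?A" "is_lub P s D" for D s
  proof -
    have "D \<subseteq> inductive_closure P B" "\<And>d. d \<in> D \<Longrightarrow> Q d" using D(2) by auto
    with D(1,3) show ?thesis using inductive_closure_lub[of P D B s] lub[of D s] by simp
  qed
  moreover have "B \<subseteq> ?A" "?A \<subseteq> carrier P"
    using inductive_closure_base[of B P] inductive_closure_subset[OF B] base by auto
  ultimately have "inductive_closure P B \<subseteq> ?A"
    by (intro inductive_closure_least)
  then show ?thesis using x by blast
qed

section \<open>The dcpos of continuous and of minimal valuations\<close>

abbreviation minimals :: "'r::d_rag itself \<Rightarrow> 'x gorder \<Rightarrow> (('x \<Rightarrow> 'r) \<Rightarrow> 'r) set" where
  "minimals R X \<equiv>
     inductive_closure (valuations R (scott X)) (elementary_valuations R (scott X))"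

lemma elementary_subset: "elementary_valuations R X \<subseteq> carrier (valuations R X)"
  by (auto simp: elementary_valuations_def)

lemma minimals_subset: "minimals R X \<subseteq> carrier (valuations R (scott X))"
  by (rule inductive_closure_subset[OF elementary_subset])

lemma carrier_minimal: "carrier (\<V> Minimal R X) = minimals R X"
  by (simp add: minimal_valuations_def)

lemma \<V>_subset: "carrier (\<V> k R X) \<subseteq> carrier (valuations R (scott X))"
  using minimals_subset by (cases k) (auto simp: minimal_valuations_def)

lemma \<V>_eq: "\<V> k R X = pointwise (cmaps R X) (carrier (\<V> k R X))"
  by (cases k) (simp_all add: minimal_valuations_def valuations_def pointwise_def)

text \<open>A family directed among minimal valuations is directed among all valuations, its
  pointwise lub is its lub there, and the inductive closure contains such lubs. Hence directed lubs
  of minimal valuations are the same in both posets.\<close>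

lemma lub_closed_\<V>: "lub_closed (cmaps R X) (carrier (\<V> k R X))"
proof (cases k)
  case Minimal
  have "s \<in> minimals R X" if D: "directed (pointwise (cmaps R X) (minimals R X)) D"
    and s: "pointwise_lub (cmaps R X) D s" for D s
  proof (rule inductive_closure_lub)
    show sub: "D \<subseteq> minimals R X" using directed_subset[OF D] by simp
    show D': "directed (valuations R (scott X)) D"
      using directed_pointwise_change[OF D subset_trans[OF sub minimals_subset]]
      by (fold valuations_eq)
    show "is_lub (valuations R (scott X)) s D"
      using s by (simp add: is_lub_valuations_iff[OF D'])
  qed
  moreover have "minimals R X \<subseteq> extensional (cmaps R X)"
    using minimals_subset[of R X] by (auto simp: valuation_iff)
  ultimately show ?thesis
    unfolding lub_closed_def Minimal carrier_minimal by simp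
qed (simp add: lub_closed_valuations)

lemma dcpo_\<V>: "dcpo (\<V> k R X)"
  by (rule dcpo_pointwise[OF lub_closed_\<V>, folded \<V>_eq])

lemma scott_continuous_\<V>_iff:
  assumes "\<And>p. p \<in> carrier P \<Longrightarrow> f p \<in> carrier (\<V> k R X)"
  shows "scott_continuous P (\<V> k R X) f \<longleftrightarrow>
    (\<forall>h\<in>cmaps R X. scott_continuous P order_poset (\<lambda>p. f p h))"
  using assms by (rule scott_continuous_pointwise_iff[OF lub_closed_\<V>, folded \<V>_eq])

lemma scott_continuous_\<V>_apply:
  assumes "scott_continuous P (\<V> k R X) f" "h \<in> cmaps R X"
  shows "scott_continuous P order_poset (\<lambda>p. f p h)"
  using assms scott_continuous_\<V>_iff[of P f k R X] scott_continuous_in[OF assms(1)] by blast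

lemma scott_continuous_\<V>_eval:
  "h \<in> cmaps R X \<Longrightarrow> scott_continuous (\<V> k R X) order_poset (\<lambda>\<nu>. \<nu> h)"
  by (rule scott_continuous_\<V>_apply[OF scott_continuous_id])

lemma \<V>_eqI:
  assumes "\<nu> \<in> carrier (\<V> k R X)" "\<nu>' \<in> carrier (\<V> k R X)"
    and "\<And>h. h \<in> cmaps R X \<Longrightarrow> \<nu> h = \<nu>' h"
  shows "\<nu> = \<nu>'"
  using assms \<V>_subset[of k R X] by (intro extensionalityI[of \<nu> "cmaps R X"]) (auto simp: valuation_iff)

section \<open>Closure under scalar multiples and sums\<close>

lemma valuation_scale:
  fixes R :: "'r::abelian_d_rag itself"
  assumes "\<nu> \<in> carrier (valuations R (scott X))"
  shows "(\<lambda>h\<in>cmaps R X. a * \<nu> h) \<in> carrier (valuations R (scott X))"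
proof -
  have "scott_continuous (cont_maps R (scott X)) order_poset (\<lambda>h\<in>cmaps R X. a * \<nu> h)"
    using assms scott_continuous_cong[of "cont_maps R (scott X)" "\<lambda>h\<in>cmaps R X. a * \<nu> h" "\<lambda>h. a * \<nu> h"]
    by (simp add: valuation_iff scott_continuous_cmult)
  then show ?thesis
    \<comment> \<open>\<open>mult.left_commute\<close> exchanges \<open>a\<close> with the scalar of
      homogeneity: a * (b * \<nu> h) = b * (a * \<nu> h).\<close>
    using assms by (simp add: valuation_iff cmaps_scale cmaps_add distrib_left mult.left_commute)
qed

lemma valuation_add:
  assumes "\<nu> \<in> carrier (valuations R (scott X))" "\<nu>' \<in> carrier (valuations R (scott X))"
  shows "(\<lambda>h\<in>cmaps R X. \<nu> h + \<nu>' h) \<in> carrier (valuations R (scott X))"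
proof -
  have "scott_continuous (cont_maps R (scott X)) order_poset (\<lambda>h\<in>cmaps R X. \<nu> h + \<nu>' h)"
    using assms scott_continuous_cong[of "cont_maps R (scott X)"
        "\<lambda>h\<in>cmaps R X. \<nu> h + \<nu>' h" "\<lambda>h. \<nu> h + \<nu>' h"]
    by (simp add: valuation_iff scott_continuous_add)
  then show ?thesis
    using assms by (simp add: valuation_iff cmaps_scale cmaps_add distrib_left ac_simps)
qed

text \<open>Induction over the closure: \<open>F\<close> carries a directed family to a directed
  family and its lub to the lub. \<open>F\<close> is defined on all valuations, so its continuity
  can be stated before it is known to preserve minimality.\<close>

lemma minimals_map:
  assumes F: "scott_continuous (valuations R (scott X)) (valuations R (scott Y)) F"
    and base: "\<And>\<nu>. \<nu> \<in> elementary_valuations R (scott X) \<Longrightarrow> F \<nu> \<in> minimals R Y"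
    and \<nu>: "\<nu> \<in> minimals R X"
  shows "F \<nu> \<in> minimals R Y"
  using \<nu> elementary_subset base
proof (rule inductive_closure_induct)
  fix D s assume D: "directed (valuations R (scott X)) D" "is_lub (valuations R (scott X)) s D"
    and "\<And>d. d \<in> D \<Longrightarrow> F d \<in> minimals R Y"
  then show "F s \<in> minimals R Y"
    using scott_continuous_directed[OF F D(1)] scott_continuous_lub[OF F D]
    by (intro inductive_closure_lub) auto
qed

lemma elementaryI:
  fixes n :: nat
  assumes "\<nu> \<in> carrier (valuations R (scott X))" "n \<ge> 1"
    and "\<And>i. i \<in> {1..n} \<Longrightarrow> x i \<in> carrier X"
    and "\<And>h. h \<in> cmaps R X \<Longrightarrow> \<nu> h = (\<Sum>i=1..n. r i * h (x i))"
  shows "\<nu> \<in> elementary_valuations R (scott X)"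
proof -
  have "\<nu> = (\<lambda>h\<in>cmaps R X. \<Sum>i=1..n. r i * h (x i))"
    using assms(1,4) by (intro extensionalityI[of _ "cmaps R X"]) (auto simp: valuation_iff)
  then have "\<exists>n r x. n \<ge> (1::nat) \<and> (\<forall>i\<in>{1..n}. x i \<in> carrier X) \<and>
      \<nu> = (\<lambda>h\<in>cmaps R X. \<Sum>i=1..n. r i * h (x i))"
    using assms(2,3) by (intro exI[of _ n] exI[of _ r] exI[of _ x]) simp
  then show ?thesis
    using assms(1) unfolding elementary_valuations_def topspace_scott by simp
qed

lemma elementaryE:
  assumes "\<nu> \<in> elementary_valuations R (scott X)"
  obtains n r x where "n \<ge> (1::nat)" "\<And>i. i \<in> {1..n} \<Longrightarrow> x i \<in> carrier X"
    "\<And>h. h \<in> cmaps R X \<Longrightarrow> \<nu> h = (\<Sum>i=1..n. r i * h (x i))"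
proof -
  obtain n r x where "n \<ge> (1::nat)" "\<forall>i\<in>{1..n}. x i \<in> carrier X"
    "\<nu> = (\<lambda>h\<in>cmaps R X. \<Sum>i=1..n. r i * h (x i))"
    using assms unfolding elementary_valuations_def topspace_scott by blast
  then show thesis by (intro that[of n x r]) auto
qed

text \<open>The empty sum would require a * 0 = 0, which a rag does not guarantee; from one summand
  on, distributivity suffices.\<close>

lemma mult_sum_nonempty:
  fixes a :: "'r::rag" and n :: nat
  assumes "n \<ge> 1"
  shows "a * (\<Sum>i=1..n. f i) = (\<Sum>i=1..n. a * f i)"
  using assms by (induction n rule: nat_induct_at_least) (simp_all add: distrib_left)

lemma minimals_scale:
  fixes R :: "'r::abelian_d_rag itself"
  assumes "\<nu> \<in> minimals R X"
  shows "(\<lambda>h\<in>cmaps R X. a * \<nu> h) \<in> minimals R X"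
proof (rule minimals_map[OF _ _ assms])
  show "scott_continuous (valuations R (scott X)) (valuations R (scott X)) (\<lambda>\<nu>. \<lambda>h\<in>cmaps R X. a * \<nu> h)"
    \<comment> \<open>With the tag \<open>Continuous\<close>, \<open>\<V>\<close> is
      \<open>valuations\<close>, so continuity can be checked at each \<open>h\<close>, where it is
      continuity of evaluation followed by multiplication.\<close>
    using scott_continuous_\<V>_iff[of "valuations R (scott X)" _ Continuous R X]
      scott_continuous_\<V>_eval[of _ R X Continuous]
    by (simp add: valuation_scale scott_continuous_cmult)
next
  fix \<nu> assume \<nu>: "\<nu> \<in> elementary_valuations R (scott X)"
  then obtain n r x where *: "n \<ge> (1::nat)" "\<And>i. i \<in> {1..n} \<Longrightarrow> x i \<in> carrier X"
    "\<And>h. h \<in> cmaps R X \<Longrightarrow> \<nu> h = (\<Sum>i=1..n. r i * h (x i))"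
    by (rule elementaryE) blast
  have "(\<lambda>h\<in>cmaps R X. a * \<nu> h) \<in> elementary_valuations R (scott X)"
    using \<nu> elementary_subset * mult_sum_nonempty[OF *(1)]
    by (intro elementaryI[where n=n and x=x and r="\<lambda>i. a * r i"] valuation_scale)
      (auto simp: mult.assoc)
  then show "(\<lambda>h\<in>cmaps R X. a * \<nu> h) \<in> minimals R X"
    by (rule subsetD[OF inductive_closure_base])
qed

lemma elementary_add:
  assumes "\<nu> \<in> elementary_valuations R (scott X)" "\<nu>' \<in> elementary_valuations R (scott X)"
  shows "(\<lambda>h\<in>cmaps R X. \<nu> h + \<nu>' h) \<in> elementary_valuations R (scott X)"
proof -
  obtain n r x where 1: "n \<ge> (1::nat)" "\<And>i. i \<in> {1..n} \<Longrightarrow> x i \<in> carrier X"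
    "\<And>h. h \<in> cmaps R X \<Longrightarrow> \<nu> h = (\<Sum>i=1..n. r i * h (x i))"
    using assms(1) by (rule elementaryE) blast
  obtain n' r' x' where 2: "n' \<ge> (1::nat)" "\<And>i. i \<in> {1..n'} \<Longrightarrow> x' i \<in> carrier X"
    "\<And>h. h \<in> cmaps R X \<Longrightarrow> \<nu>' h = (\<Sum>i=1..n'. r' i * h (x' i))"
    using assms(2) by (rule elementaryE) blast
  \<comment> \<open>The two lists of terms are concatenated: indices above \<open>n\<close> are
    shifted down by \<open>n\<close> into those of the second list.\<close>
  define q where "q i = (if i \<le> n then r i else r' (i - n))" for i
  define y where "y i = (if i \<le> n then x i else x' (i - n))" for i
  have "(\<Sum>i=1..n + n'. q i * h (y i)) = (\<Sum>i=1..n. r i * h (x i)) + (\<Sum>i=1..n'. r' i * h (x' i))" for h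
  proof -
    have "(\<Sum>i=n+1..n + n'. q i * h (y i)) = (\<Sum>i=1..n'. r' i * h (x' i))"
      by (rule sum.reindex_bij_witness[of _ "\<lambda>i. i + n" "\<lambda>i. i - n"]) (auto simp: q_def y_def)
    moreover have "(\<Sum>i=1..n. q i * h (y i)) = (\<Sum>i=1..n. r i * h (x i))"
      by (rule sum.cong) (auto simp: q_def y_def)
    moreover have "(\<Sum>i=1..n + n'. q i * h (y i)) =
        (\<Sum>i=1..n. q i * h (y i)) + (\<Sum>i=n+1..n + n'. q i * h (y i))"
      by (rule sum.ub_add_nat) simp
    ultimately show ?thesis by simp
  qed
  moreover have "y i \<in> carrier X" if "i \<in> {1..n + n'}" for i
  proof (cases "i \<le> n")
    case False
    then have "i - n \<in> {1..n'}" using that by auto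
    with False 2(2) show ?thesis by (simp add: y_def)
  qed (use that 1(2) in \<open>simp add: y_def\<close>)
  ultimately show ?thesis
    using subsetD[OF elementary_subset assms(1)] subsetD[OF elementary_subset assms(2)] 1 2
    by (intro elementaryI[where n="n + n'" and x=y and r=q] valuation_add) auto
qed

text \<open>Induction on one summand at a time: from elementary plus elementary to minimal plus
  elementary, and from there to minimal plus minimal. Each stage uses that adding a fixed valuation
  is continuous.\<close>

lemma minimals_add:
  assumes "\<nu> \<in> minimals R X" "\<nu>' \<in> minimals R X"
  shows "(\<lambda>h\<in>cmaps R X. \<nu> h + \<nu>' h) \<in> minimals R X"
proof -
  have cont: "scott_continuous (valuations R (scott X)) (valuations R (scott X))
      (\<lambda>\<nu>. \<lambda>h\<in>cmaps R X. \<nu> h + \<nu>' h)"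
    if "\<nu>' \<in> carrier (valuations R (scott X))" for \<nu>'
    using that scott_continuous_\<V>_iff[of "valuations R (scott X)" _ Continuous R X]
      scott_continuous_\<V>_eval[of _ R X Continuous]
    by (simp add: valuation_add scott_continuous_add scott_continuous_const_order_poset)
  have *: "(\<lambda>h\<in>cmaps R X. \<nu> h + \<nu>' h) \<in> minimals R X"
    if \<nu>: "\<nu> \<in> minimals R X" and \<nu>': "\<nu>' \<in> elementary_valuations R (scott X)" for \<nu> \<nu>'
    using cont[OF subsetD[OF elementary_subset \<nu>']] _ \<nu>
    by (rule minimals_map) (rule subsetD[OF inductive_closure_base elementary_add[OF _ \<nu>']])
  show ?thesis
    using cont[OF subsetD[OF minimals_subset assms(2)]] _ assms(1)
  proof (rule minimals_map)
    fix \<nu> assume "\<nu> \<in> elementary_valuations R (scott X)"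
    \<comment> \<open>The first stage is used with the summands exchanged; commutativity of +
      restores their order.\<close>
    from *[OF assms(2) this] show "(\<lambda>h\<in>cmaps R X. \<nu> h + \<nu>' h) \<in> minimals R X"
      by (simp add: add.commute)
  qed
qed


section \<open>The monad\<close>

lemma dcpo_hom_cont: "f \<in> dcpo_hom P Q \<Longrightarrow> scott_continuous P Q f"
  by (simp add: dcpo_hom_def)

lemma dcpo_hom_in: "f \<in> dcpo_hom P Q \<Longrightarrow> x \<in> carrier P \<Longrightarrow> f x \<in> carrier Q"
  by (rule scott_continuous_in[OF dcpo_hom_cont])

lemma restrict_dcpo_hom: "scott_continuous P Q f \<Longrightarrow> restrict f (carrier P) \<in> dcpo_hom P Q"
  using scott_continuous_cong[of P "restrict f (carrier P)" f Q] by (simp add: dcpo_hom_def)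

lemma dcpo_hom_compose:
  assumes "f \<in> dcpo_hom P Q" "g \<in> dcpo_hom Q S"
  shows "compose (carrier P) g f \<in> dcpo_hom P S"
  unfolding compose_def
  by (rule restrict_dcpo_hom[OF scott_continuous_compose[OF assms[THEN dcpo_hom_cont]]])

lemma cmaps_compose:
  assumes "f \<in> dcpo_hom X Y" "h \<in> cmaps R Y"
  shows "(\<lambda>x\<in>carrier X. h (f x)) \<in> cmaps R X"
  using assms(2)
  by (intro restrict_cmaps scott_continuous_compose[OF dcpo_hom_cont[OF assms(1)]]) (simp add: cmaps_iff)

lemma id_hom_dcpo_hom: "id_hom P \<in> dcpo_hom P P"
  unfolding id_hom_def by (intro restrict_dcpo_hom scott_continuous_id)

lemma dcpo_hom_\<V>_eqI:
  assumes "f \<in> dcpo_hom P (\<V> k R X)" "g \<in> dcpo_hom P (\<V> k R X)"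
    and "\<And>p h. p \<in> carrier P \<Longrightarrow> h \<in> cmaps R X \<Longrightarrow> f p h = g p h"
  shows "f = g"
proof (rule extensionalityI)
  show "f \<in> extensional (carrier P)" "g \<in> extensional (carrier P)"
    using assms(1,2) by (simp_all add: dcpo_hom_def)
  show "f p = g p" if "p \<in> carrier P" for p
    using dcpo_hom_in[OF assms(1) that] dcpo_hom_in[OF assms(2) that] assms(3)[OF that]
    by (rule \<V>_eqI)
qed

section \<open>The unit\<close>

lemma \<eta>_apply: "x \<in> carrier X \<Longrightarrow> h \<in> cmaps R X \<Longrightarrow> \<eta> R X x h = h x"
  by (simp add: \<eta>_def)

lemma \<eta>_in:
  assumes x: "x \<in> carrier X"
  shows "\<eta> R X x \<in> carrier (\<V> k R X)"
proof -
  have "scott_continuous (cont_maps R (scott X)) order_poset (\<eta> R X x)"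
    using scott_continuous_cmaps_eval[OF x]
      scott_continuous_cong[of "cont_maps R (scott X)" "\<eta> R X x" "\<lambda>h. h x", OF \<eta>_apply[OF x]]
    by blast
  then have val: "\<eta> R X x \<in> carrier (valuations R (scott X))"
    using x by (simp add: valuation_iff \<eta>_apply cmaps_scale cmaps_add) (simp add: \<eta>_def)
  have "\<eta> R X x \<in> elementary_valuations R (scott X)"
    \<comment> \<open>A point valuation is the one-term combination with coefficient 1.\<close>
    using val x by (intro elementaryI[where n=1 and r="\<lambda>_. 1" and x="\<lambda>_. x"]) (simp_all add: \<eta>_apply)
  then have "\<eta> R X x \<in> minimals R X"
    by (rule subsetD[OF inductive_closure_base])
  with val show ?thesis by (cases k) (simp_all add: minimal_valuations_def)
qed

lemma \<eta>_hom: "\<eta> R X \<in> dcpo_hom X (\<V> k R X)"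
proof -
  have "scott_continuous X order_poset (\<lambda>x. \<eta> R X x h)" if h: "h \<in> cmaps R X" for h
    using h scott_continuous_cong[of X "\<lambda>x. \<eta> R X x h" h] by (simp add: \<eta>_apply cmaps_iff)
  then have "scott_continuous X (\<V> k R X) (\<eta> R X)"
    using scott_continuous_\<V>_iff[of X "\<eta> R X" k R X, OF \<eta>_in] by blast
  then show ?thesis by (simp add: dcpo_hom_def \<eta>_def)
qed

section \<open>Kleisli extension\<close>

lemma slice_cmaps:
  assumes "f \<in> dcpo_hom X (\<V> k R Y)" "h \<in> cmaps R Y"
  shows "(\<lambda>x\<in>carrier X. f x h) \<in> cmaps R X"
  by (rule restrict_cmaps scott_continuous_\<V>_apply dcpo_hom_cont assms)+

text \<open>The extension of \<open>f\<close> at \<nu> is \<nu> after this map. Continuity in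
  \<open>h\<close> holds because every \<open>f x\<close> is itself a Scott-continuous
  functional.\<close>

lemma slice_cont:
  assumes f: "f \<in> dcpo_hom X (\<V> k R Y)"
  shows "scott_continuous (cont_maps R (scott Y)) (cont_maps R (scott X)) (\<lambda>h. \<lambda>x\<in>carrier X. f x h)"
proof (rule scott_continuous_cmaps)
  show "scott_continuous X order_poset (\<lambda>x. f x h)" if "h \<in> cmaps R Y" for h
    by (rule scott_continuous_\<V>_apply dcpo_hom_cont f that)+
  show "scott_continuous (cont_maps R (scott Y)) order_poset (f x)" if "x \<in> carrier X" for x
    using subsetD[OF \<V>_subset dcpo_hom_in[OF f that]] by (simp add: valuation_iff)
qed

lemma ext_apply:
  "\<nu> \<in> carrier (\<V> k R X) \<Longrightarrow> h \<in> cmaps R Y \<Longrightarrow> ext k R X Y f \<nu> h = \<nu> (\<lambda>x\<in>carrier X. f x h)"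
  by (simp add: ext_def)

text \<open>Each law is used twice, for every \<open>f x\<close> and for \<nu>. Here \<nu> ranges
  over all valuations whatever \<open>k\<close> is, because minimality is later transferred along a
  map on all of them.\<close>

lemma valuation_ext:
  assumes f: "f \<in> dcpo_hom X (\<V> k R Y)" and \<nu>: "\<nu> \<in> carrier (valuations R (scott X))"
  shows "(\<lambda>h\<in>cmaps R Y. \<nu> (\<lambda>x\<in>carrier X. f x h)) \<in> carrier (valuations R (scott Y))"
proof -
  let ?F = "\<lambda>h. \<nu> (\<lambda>x\<in>carrier X. f x h)"
  have fx: "f x \<in> carrier (valuations R (scott Y))" if "x \<in> carrier X" for x
    using subsetD[OF \<V>_subset dcpo_hom_in[OF f that]] .
  have "scott_continuous (cont_maps R (scott Y)) order_poset ?F"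
    using \<nu> by (intro scott_continuous_compose[OF slice_cont[OF f]]) (simp add: valuation_iff)
  then have "scott_continuous (cont_maps R (scott Y)) order_poset (restrict ?F (cmaps R Y))"
    using scott_continuous_cong[of "cont_maps R (scott Y)" "restrict ?F (cmaps R Y)" ?F] by simp
  moreover have "?F (\<lambda>y\<in>carrier Y. a * h y) = a * ?F h" if h: "h \<in> cmaps R Y" for a h
  proof -
    \<comment> \<open>The inner restriction displays the slice as an element of
      \<open>cmaps\<close>, so that the law for \<nu> matches it literally.\<close>
    have "(\<lambda>x\<in>carrier X. f x (\<lambda>y\<in>carrier Y. a * h y)) =
        (\<lambda>x\<in>carrier X. a * (\<lambda>x\<in>carrier X. f x h) x)"
      using fx h by (intro restrict_ext) (simp add: valuation_iff)
    with slice_cmaps[OF f h] \<nu> show ?thesis by (simp only: valuation_iff)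
  qed
  moreover have "?F (\<lambda>y\<in>carrier Y. h y + h' y) = ?F h + ?F h'"
    if h: "h \<in> cmaps R Y" "h' \<in> cmaps R Y" for h h'
  proof -
    have "(\<lambda>x\<in>carrier X. f x (\<lambda>y\<in>carrier Y. h y + h' y)) =
        (\<lambda>x\<in>carrier X. (\<lambda>x\<in>carrier X. f x h) x + (\<lambda>x\<in>carrier X. f x h') x)"
      using fx h by (intro restrict_ext) (simp add: valuation_iff)
    with slice_cmaps[OF f h(1)] slice_cmaps[OF f h(2)] \<nu> show ?thesis by (simp only: valuation_iff)
  qed
  ultimately show ?thesis
    by (simp add: valuation_iff cmaps_scale cmaps_add)
qed

lemma scott_continuous_valuation_ext:
  assumes f: "f \<in> dcpo_hom X (\<V> k R Y)"
  shows "scott_continuous (valuations R (scott X)) (valuations R (scott Y))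
    (\<lambda>\<nu>. \<lambda>h\<in>cmaps R Y. \<nu> (\<lambda>x\<in>carrier X. f x h))"
  using scott_continuous_\<V>_iff[of "valuations R (scott X)" _ Continuous R Y]
    scott_continuous_\<V>_eval[of _ R X Continuous]
  by (simp add: valuation_ext[OF f] slice_cmaps[OF f])

text \<open>Induction from one term on, by scaling and adding. The empty combination is constantly 0
  and need not be homogeneous in a rag.\<close>

lemma minimals_sum:
  fixes R :: "'r::abelian_d_rag itself" and n :: nat
  assumes "n \<ge> 1" "\<And>i. i \<in> {1..n} \<Longrightarrow> \<nu> i \<in> minimals R X"
  shows "(\<lambda>h\<in>cmaps R X. \<Sum>i=1..n. r i * \<nu> i h) \<in> minimals R X"
  using assms
proof (induction n rule: nat_induct_at_least)
  case base
  then show ?case using minimals_scale[of "\<nu> 1" R X "r 1"] by (simp add: restrict_def)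
next
  case (Suc n)
  have IH: "(\<lambda>h\<in>cmaps R X. \<Sum>i=1..n. r i * \<nu> i h) \<in> minimals R X"
    by (rule Suc.IH) (use Suc.prems in auto)
  have last: "(\<lambda>h\<in>cmaps R X. r (Suc n) * \<nu> (Suc n) h) \<in> minimals R X"
    using Suc.prems by (intro minimals_scale) simp
  have "(\<lambda>h\<in>cmaps R X. \<Sum>i=1..Suc n. r i * \<nu> i h) =
      (\<lambda>h\<in>cmaps R X. (\<lambda>h\<in>cmaps R X. \<Sum>i=1..n. r i * \<nu> i h) h +
        (\<lambda>h\<in>cmaps R X. r (Suc n) * \<nu> (Suc n) h) h)"
    by (rule restrict_ext) simp
  with minimals_add[OF IH last] show ?case by (simp only:)
qed

lemma minimals_ext:
  fixes R :: "'r::abelian_d_rag itself"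
  assumes f: "f \<in> dcpo_hom X (\<V> Minimal R Y)" and \<nu>: "\<nu> \<in> minimals R X"
  shows "(\<lambda>h\<in>cmaps R Y. \<nu> (\<lambda>x\<in>carrier X. f x h)) \<in> minimals R Y"
  using scott_continuous_valuation_ext[OF f] _ \<nu>
proof (rule minimals_map)
  fix \<nu> assume \<nu>: "\<nu> \<in> elementary_valuations R (scott X)"
  then obtain n r x where *: "n \<ge> (1::nat)" "\<And>i. i \<in> {1..n} \<Longrightarrow> x i \<in> carrier X"
    "\<And>h. h \<in> cmaps R X \<Longrightarrow> \<nu> h = (\<Sum>i=1..n. r i * h (x i))"
    by (rule elementaryE) blast
  have "(\<lambda>h\<in>cmaps R Y. \<nu> (\<lambda>x\<in>carrier X. f x h)) = (\<lambda>h\<in>cmaps R Y. \<Sum>i=1..n. r i * f (x i) h)"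
    using *(2) by (intro restrict_ext) (simp add: *(3)[OF slice_cmaps[OF f]])
  also have "\<dots> \<in> minimals R Y"
    using *(1)
  proof (rule minimals_sum)
    show "f (x i) \<in> minimals R Y" if "i \<in> {1..n}" for i
      using dcpo_hom_in[OF f *(2)[OF that]] by (simp only: carrier_minimal)
  qed
  finally show "(\<lambda>h\<in>cmaps R Y. \<nu> (\<lambda>x\<in>carrier X. f x h)) \<in> minimals R Y" .
qed

lemma ext_in:
  fixes R :: "'r::abelian_d_rag itself"
  assumes f: "f \<in> dcpo_hom X (\<V> k R Y)" and \<nu>: "\<nu> \<in> carrier (\<V> k R X)"
  shows "ext k R X Y f \<nu> \<in> carrier (\<V> k R Y)"
proof (cases k)
  case Continuous
  then show ?thesis using valuation_ext[OF f] \<nu> by (simp add: ext_def)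
next
  case Minimal
  then show ?thesis
    using minimals_ext[of f X R Y \<nu>] f \<nu> unfolding Minimal carrier_minimal
    by (simp add: ext_def minimal_valuations_def)
qed

lemma ext_hom:
  fixes R :: "'r::abelian_d_rag itself"
  assumes f: "f \<in> dcpo_hom X (\<V> k R Y)"
  shows "ext k R X Y f \<in> dcpo_hom (\<V> k R X) (\<V> k R Y)"
proof -
  have "scott_continuous (\<V> k R X) order_poset (\<lambda>\<nu>. ext k R X Y f \<nu> h)" if h: "h \<in> cmaps R Y" for h
    using scott_continuous_\<V>_eval[OF slice_cmaps[OF f h]] h
    by (subst scott_continuous_cong) (simp_all add: ext_apply)
  then have "scott_continuous (\<V> k R X) (\<V> k R Y) (ext k R X Y f)"
    using scott_continuous_\<V>_iff[of "\<V> k R X" "ext k R X Y f" k R Y, OF ext_in[OF f]] by blast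
  then show ?thesis by (simp add: dcpo_hom_def ext_def)
qed

section \<open>The laws of a Manes monad\<close>

lemma ext_\<eta>:
  fixes R :: "'r::abelian_d_rag itself"
  assumes f: "f \<in> dcpo_hom X (\<V> k R Y)"
  shows "compose (carrier X) (ext k R X Y f) (\<eta> R X) = f"
  using dcpo_hom_compose[OF \<eta>_hom ext_hom[OF f]] f
  by (rule dcpo_hom_\<V>_eqI)
    (simp add: compose_eq ext_apply \<eta>_in \<eta>_apply slice_cmaps[OF f])

lemma ext_\<eta>_id:
  fixes R :: "'r::abelian_d_rag itself"
  shows "ext k R X X (\<eta> R X) = id_hom (\<V> k R X)"
  using ext_hom[OF \<eta>_hom] id_hom_dcpo_hom
proof (rule dcpo_hom_\<V>_eqI)
  fix \<nu> h assume \<nu>: "\<nu> \<in> carrier (\<V> k R X)" and h: "h \<in> cmaps R X"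
  have "(\<lambda>x\<in>carrier X. \<eta> R X x h) = h"
    using h by (intro extensionalityI[of _ "carrier X"]) (simp_all add: \<eta>_apply cmaps_iff)
  then show "ext k R X X (\<eta> R X) \<nu> h = id_hom (\<V> k R X) \<nu> h"
    using \<nu> h by (simp add: ext_apply id_hom_def)
qed

lemma ext_ext:
  fixes R :: "'r::abelian_d_rag itself"
  assumes f: "f \<in> dcpo_hom X (\<V> k R Y)" and g: "g \<in> dcpo_hom Y (\<V> k R Z)"
  shows "ext k R X Z (compose (carrier X) (ext k R Y Z g) f) =
    compose (carrier (\<V> k R X)) (ext k R Y Z g) (ext k R X Y f)"
  using ext_hom[OF dcpo_hom_compose[OF f ext_hom[OF g]]]
    dcpo_hom_compose[OF ext_hom[OF f] ext_hom[OF g]]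
proof (rule dcpo_hom_\<V>_eqI)
  fix \<nu> h assume \<nu>: "\<nu> \<in> carrier (\<V> k R X)" and h: "h \<in> cmaps R Z"
  \<comment> \<open>Slicing the composite at \<open>h\<close> amounts to slicing \<open>f\<close> at
    the slice of \<open>g\<close>; both sides then apply \<nu> to this map.\<close>
  have "(\<lambda>x\<in>carrier X. compose (carrier X) (ext k R Y Z g) f x h) =
      (\<lambda>x\<in>carrier X. f x (\<lambda>y\<in>carrier Y. g y h))"
    by (rule restrict_ext) (simp add: compose_eq ext_apply dcpo_hom_in[OF f] h)
  then show "ext k R X Z (compose (carrier X) (ext k R Y Z g) f) \<nu> h =
      compose (carrier (\<V> k R X)) (ext k R Y Z g) (ext k R X Y f) \<nu> h"
    by (simp add: compose_eq ext_apply ext_in[OF f] slice_cmaps[OF g] \<nu> h)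
qed

section \<open>Functor action and multiplication\<close>

lemma \<V>_map_hom:
  fixes R :: "'r::abelian_d_rag itself"
  assumes "g \<in> dcpo_hom X Y"
  shows "\<V>_map k R X Y g \<in> dcpo_hom (\<V> k R X) (\<V> k R Y)"
  unfolding \<V>_map_def by (rule ext_hom dcpo_hom_compose assms \<eta>_hom)+

text \<open>The functor acts by push-forward: the slice at \<open>h\<close> of the unit after
  \<open>g\<close> collapses to \<open>h\<close> after \<open>g\<close>.\<close>

lemma \<V>_map_apply:
  assumes "g \<in> dcpo_hom X Y" "\<nu> \<in> carrier (\<V> k R X)" "h \<in> cmaps R Y"
  shows "\<V>_map k R X Y g \<nu> h = \<nu> (\<lambda>x\<in>carrier X. h (g x))"
proof -
  have "(\<lambda>x\<in>carrier X. compose (carrier X) (\<eta> R Y) g x h) = (\<lambda>x\<in>carrier X. h (g x))"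
    by (rule restrict_ext) (simp add: compose_eq \<eta>_apply dcpo_hom_in[OF assms(1)] assms(3))
  then show ?thesis using assms by (simp add: \<V>_map_def ext_apply)
qed

lemma \<mu>_hom:
  fixes R :: "'r::abelian_d_rag itself"
  shows "\<mu> k R X \<in> dcpo_hom (\<V> k R (\<V> k R X)) (\<V> k R X)"
  unfolding \<mu>_def by (rule ext_hom[OF id_hom_dcpo_hom])

lemma \<mu>_apply:
  assumes "\<xi> \<in> carrier (\<V> k R (\<V> k R X))" "h \<in> cmaps R X"
  shows "\<mu> k R X \<xi> h = \<xi> (\<lambda>\<nu>\<in>carrier (\<V> k R X). \<nu> h)"
  using assms by (simp add: \<mu>_def ext_apply id_hom_def cong: restrict_cong)


section \<open>The strength\<close>

lemma prod_hom_dcpo_hom: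
  assumes "f \<in> dcpo_hom P P'" "g \<in> dcpo_hom Q Q'"
  shows "prod_hom P Q f g \<in> dcpo_hom (P \<otimes>\<^sub>d Q) (P' \<otimes>\<^sub>d Q')"
proof -
  have "scott_continuous (P \<otimes>\<^sub>d Q) (P' \<otimes>\<^sub>d Q') (\<lambda>p. (f (fst p), g (snd p)))"
    using assms by (intro scott_continuous_Pair scott_continuous_compose[OF scott_continuous_fst]
        scott_continuous_compose[OF scott_continuous_snd] dcpo_hom_cont)
  from restrict_dcpo_hom[OF this] show ?thesis by (simp only: prod_hom_def case_prod_unfold)
qed

lemma unitor_dcpo_hom: "unitor P \<in> dcpo_hom (one_dcpo \<otimes>\<^sub>d P) P"
  using restrict_dcpo_hom[OF scott_continuous_snd, of one_dcpo P]
  by (simp only: unitor_def case_prod_unfold)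

lemma assoc_dcpo_hom: "assoc P Q S \<in> dcpo_hom ((P \<otimes>\<^sub>d Q) \<otimes>\<^sub>d S) (P \<otimes>\<^sub>d (Q \<otimes>\<^sub>d S))"
proof -
  have "scott_continuous ((P \<otimes>\<^sub>d Q) \<otimes>\<^sub>d S) (P \<otimes>\<^sub>d (Q \<otimes>\<^sub>d S)) (\<lambda>p. (fst (fst p), (snd (fst p), snd p)))"
    by (intro scott_continuous_Pair scott_continuous_snd
        scott_continuous_compose[OF scott_continuous_fst scott_continuous_fst]
        scott_continuous_compose[OF scott_continuous_fst scott_continuous_snd])
  from restrict_dcpo_hom[OF this] show ?thesis by (simp only: assoc_def case_prod_unfold)
qed

section \<open>Sections and the strength\<close>

lemma scott_continuous_Pair_left:
  "partial_order X \<Longrightarrow> x \<in> carrier X \<Longrightarrow> scott_continuous Y (X \<otimes>\<^sub>d Y) (\<lambda>y. (x, y))"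
  by (intro scott_continuous_Pair scott_continuous_const scott_continuous_id)

lemma scott_continuous_Pair_right:
  "partial_order Y \<Longrightarrow> y \<in> carrier Y \<Longrightarrow> scott_continuous X (X \<otimes>\<^sub>d Y) (\<lambda>x. (x, y))"
  by (intro scott_continuous_Pair scott_continuous_const scott_continuous_id)

lemma section_cmaps:
  assumes "partial_order X" "x \<in> carrier X" "h \<in> cmaps R (X \<otimes>\<^sub>d Y)"
  shows "(\<lambda>y\<in>carrier Y. h (x, y)) \<in> cmaps R Y"
proof -
  have "scott_continuous (X \<otimes>\<^sub>d Y) order_poset h" using assms(3) by (simp add: cmaps_iff)
  from restrict_cmaps[OF scott_continuous_compose[OF scott_continuous_Pair_left[OF assms(1,2)] this]]
  show ?thesis .
qed

lemma strength_apply: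
  "x \<in> carrier X \<Longrightarrow> \<nu> \<in> carrier (\<V> k R Y) \<Longrightarrow> h \<in> cmaps R (X \<otimes>\<^sub>d Y) \<Longrightarrow>
    strength k R X Y (x, \<nu>) h = \<nu> (\<lambda>y\<in>carrier Y. h (x, y))"
  by (simp add: strength_def)

lemma strength_in:
  fixes R :: "'r::abelian_d_rag itself"
  assumes X: "partial_order X" and x: "x \<in> carrier X" and \<nu>: "\<nu> \<in> carrier (\<V> k R Y)"
  shows "strength k R X Y (x, \<nu>) \<in> carrier (\<V> k R (X \<otimes>\<^sub>d Y))"
proof -
  let ?g = "\<lambda>y\<in>carrier Y. (x, y)"
  have g: "?g \<in> dcpo_hom Y (X \<otimes>\<^sub>d Y)"
    by (rule restrict_dcpo_hom[OF scott_continuous_Pair_left[OF X x]])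
  have "strength k R X Y (x, \<nu>) = \<V>_map k R Y (X \<otimes>\<^sub>d Y) ?g \<nu>"
  proof (rule extensionalityI)
    show "strength k R X Y (x, \<nu>) h = \<V>_map k R Y (X \<otimes>\<^sub>d Y) ?g \<nu> h"
      if h: "h \<in> cmaps R (X \<otimes>\<^sub>d Y)" for h
      unfolding strength_apply[OF x \<nu> h] \<V>_map_apply[OF g \<nu> h]
      by (intro arg_cong[of _ _ \<nu>] restrict_ext) simp
  qed (use x \<nu> in \<open>simp_all add: strength_def \<V>_map_def ext_def\<close>)
  also have "\<dots> \<in> carrier (\<V> k R (X \<otimes>\<^sub>d Y))"
    by (rule dcpo_hom_in[OF \<V>_map_hom[OF g] \<nu>])
  finally show ?thesis .
qed

text \<open>At each \<open>h\<close>, continuity is checked separately in the two variables. In the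
  valuation it is evaluation at a section of \<open>h\<close>; in the point it is the curried
  \<open>h\<close> followed by the valuation, which is Scott-continuous itself.\<close>

lemma strength_hom:
  fixes R :: "'r::abelian_d_rag itself"
  assumes X: "partial_order X" and Y: "partial_order Y"
  shows "strength k R X Y \<in> dcpo_hom (X \<otimes>\<^sub>d \<V> k R Y) (\<V> k R (X \<otimes>\<^sub>d Y))"
proof -
  have "scott_continuous (X \<otimes>\<^sub>d \<V> k R Y) order_poset (\<lambda>p. strength k R X Y p h)"
    if h: "h \<in> cmaps R (X \<otimes>\<^sub>d Y)" for h
    using partial_order_order_poset
  proof (rule scott_continuous_separately)
    fix x assume x: "x \<in> carrier X"
    show "scott_continuous (\<V> k R Y) order_poset (\<lambda>\<nu>. strength k R X Y (x, \<nu>) h)"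
      using scott_continuous_\<V>_eval[OF section_cmaps[OF X x h]]
      by (subst scott_continuous_cong) (simp_all add: strength_apply x h)
  next
    fix \<nu> assume \<nu>: "\<nu> \<in> carrier (\<V> k R Y)"
    have "scott_continuous X (cont_maps R (scott Y)) (\<lambda>x. \<lambda>y\<in>carrier Y. h (x, y))"
      using h by (intro scott_continuous_cmaps
          scott_continuous_compose[OF scott_continuous_Pair_left[OF X]]
          scott_continuous_compose[OF scott_continuous_Pair_right[OF Y]]) (simp_all add: cmaps_iff)
    then have "scott_continuous X order_poset (\<lambda>x. \<nu> (\<lambda>y\<in>carrier Y. h (x, y)))"
      by (rule scott_continuous_compose) (use subsetD[OF \<V>_subset \<nu>] in \<open>simp add: valuation_iff\<close>)
    then show "scott_continuous X order_poset (\<lambda>x. strength k R X Y (x, \<nu>) h)"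
      by (subst scott_continuous_cong) (simp_all add: strength_apply \<nu> h)
  qed
  then have "scott_continuous (X \<otimes>\<^sub>d \<V> k R Y) (\<V> k R (X \<otimes>\<^sub>d Y)) (strength k R X Y)"
    using strength_in[OF X] by (subst scott_continuous_\<V>_iff) auto
  then show ?thesis by (simp add: dcpo_hom_def strength_def)
qed

section \<open>Naturality and coherence of the strength\<close>

lemma strength_natural:
  fixes R :: "'r::abelian_d_rag itself"
  assumes po: "partial_order X" "partial_order X'" "partial_order Y" "partial_order Y'"
    and f: "f \<in> dcpo_hom X X'" and g: "g \<in> dcpo_hom Y Y'"
  shows "compose (carrier (X \<otimes>\<^sub>d \<V> k R Y))
      (\<V>_map k R (X \<otimes>\<^sub>d Y) (X' \<otimes>\<^sub>d Y') (prod_hom X Y f g)) (strength k R X Y) =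
    compose (carrier (X \<otimes>\<^sub>d \<V> k R Y))
      (strength k R X' Y') (prod_hom X (\<V> k R Y) f (\<V>_map k R Y Y' g))"
    (is "?lhs = ?rhs")
proof (rule dcpo_hom_\<V>_eqI)
  note fg = prod_hom_dcpo_hom[OF f g]
  show "?lhs \<in> dcpo_hom (X \<otimes>\<^sub>d \<V> k R Y) (\<V> k R (X' \<otimes>\<^sub>d Y'))"
    by (rule dcpo_hom_compose strength_hom \<V>_map_hom fg po)+
  show "?rhs \<in> dcpo_hom (X \<otimes>\<^sub>d \<V> k R Y) (\<V> k R (X' \<otimes>\<^sub>d Y'))"
    by (rule dcpo_hom_compose[OF prod_hom_dcpo_hom[OF f \<V>_map_hom[OF g]] strength_hom[OF po(2,4)]])
  fix p h assume p: "p \<in> carrier (X \<otimes>\<^sub>d \<V> k R Y)" and h: "h \<in> cmaps R (X' \<otimes>\<^sub>d Y')"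
  obtain x \<nu> where x: "p = (x, \<nu>)" "x \<in> carrier X" and \<nu>: "\<nu> \<in> carrier (\<V> k R Y)"
    using p by auto
  have "?lhs p h = \<V>_map k R (X \<otimes>\<^sub>d Y) (X' \<otimes>\<^sub>d Y') (prod_hom X Y f g) (strength k R X Y (x, \<nu>)) h"
    using p by (simp add: compose_eq x(1))
  also have "\<dots> = strength k R X Y (x, \<nu>) (\<lambda>q\<in>carrier (X \<otimes>\<^sub>d Y). h (prod_hom X Y f g q))"
    by (rule \<V>_map_apply[OF fg strength_in[OF po(1) x(2) \<nu>] h])
  also have "\<dots> = \<nu> (\<lambda>y\<in>carrier Y. (\<lambda>q\<in>carrier (X \<otimes>\<^sub>d Y). h (prod_hom X Y f g q)) (x, y))"
    by (rule strength_apply[OF x(2) \<nu> cmaps_compose[OF fg h]])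
  \<comment> \<open>The common value of both sides is \<nu> at y |-> h (f x, g y); the restriction
    to \<open>Y'\<close> is harmless because \<open>g y\<close> lies in its carrier.\<close>
  also have "\<dots> = \<nu> (\<lambda>y\<in>carrier Y. (\<lambda>y'\<in>carrier Y'. h (f x, y')) (g y))"
    by (intro arg_cong[of _ _ \<nu>] restrict_ext) (simp add: prod_hom_def x(2) dcpo_hom_in[OF g])
  also have "\<dots> = \<V>_map k R Y Y' g \<nu> (\<lambda>y'\<in>carrier Y'. h (f x, y'))"
    by (rule \<V>_map_apply[OF g \<nu> section_cmaps[OF po(2) dcpo_hom_in[OF f x(2)] h], symmetric])
  also have "\<dots> = strength k R X' Y' (f x, \<V>_map k R Y Y' g \<nu>) h"
    by (rule strength_apply[OF dcpo_hom_in[OF f x(2)] dcpo_hom_in[OF \<V>_map_hom[OF g] \<nu>] h, symmetric])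
  also have "\<dots> = ?rhs p h"
    using p by (simp add: compose_eq x(1) prod_hom_def)
  finally show "?lhs p h = ?rhs p h" .
qed

lemma strength_unitor:
  fixes R :: "'r::abelian_d_rag itself"
  assumes X: "partial_order X"
  shows "compose (carrier (one_dcpo \<otimes>\<^sub>d \<V> k R X))
      (\<V>_map k R (one_dcpo \<otimes>\<^sub>d X) X (unitor X)) (strength k R one_dcpo X) =
    unitor (\<V> k R X)"
    (is "?lhs = _")
proof (rule dcpo_hom_\<V>_eqI)
  show "?lhs \<in> dcpo_hom (one_dcpo \<otimes>\<^sub>d \<V> k R X) (\<V> k R X)"
    by (rule dcpo_hom_compose strength_hom \<V>_map_hom unitor_dcpo_hom partial_order_one X)+
  show "unitor (\<V> k R X) \<in> dcpo_hom (one_dcpo \<otimes>\<^sub>d \<V> k R X) (\<V> k R X)"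
    by (rule unitor_dcpo_hom)
  fix p h assume p: "p \<in> carrier (one_dcpo \<otimes>\<^sub>d \<V> k R X)" and h: "h \<in> cmaps R X"
  obtain u \<nu> where u: "p = (u, \<nu>)" "u \<in> carrier one_dcpo" and \<nu>: "\<nu> \<in> carrier (\<V> k R X)"
    using p by auto
  have "?lhs p h = \<V>_map k R (one_dcpo \<otimes>\<^sub>d X) X (unitor X) (strength k R one_dcpo X (u, \<nu>)) h"
    using p by (simp add: compose_eq u(1))
  also have "\<dots> = strength k R one_dcpo X (u, \<nu>) (\<lambda>q\<in>carrier (one_dcpo \<otimes>\<^sub>d X). h (unitor X q))"
    by (rule \<V>_map_apply[OF unitor_dcpo_hom strength_in[OF partial_order_one u(2) \<nu>] h])
  also have "\<dots> = \<nu> (\<lambda>x\<in>carrier X. (\<lambda>q\<in>carrier (one_dcpo \<otimes>\<^sub>d X). h (unitor X q)) (u, x))"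
    by (rule strength_apply[OF u(2) \<nu> cmaps_compose[OF unitor_dcpo_hom h]])
  also have "(\<lambda>x\<in>carrier X. (\<lambda>q\<in>carrier (one_dcpo \<otimes>\<^sub>d X). h (unitor X q)) (u, x)) = h"
    using h u(2) by (intro extensionalityI[of _ "carrier X"]) (simp_all add: unitor_def cmaps_iff)
  also have "\<nu> h = unitor (\<V> k R X) p h"
    using p by (simp add: unitor_def u(1))
  finally show "?lhs p h = unitor (\<V> k R X) p h" .
qed

text \<open>At \<open>((x, y), \<nu>)\<close> and \<open>h\<close>, both sides are \<nu> applied to
  z |-> h (x, (y, z)).\<close>

lemma strength_assoc:
  fixes R :: "'r::abelian_d_rag itself"
  assumes po: "partial_order X" "partial_order Y" "partial_order Z"
  shows "compose (carrier ((X \<otimes>\<^sub>d Y) \<otimes>\<^sub>d \<V> k R Z))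
      (\<V>_map k R ((X \<otimes>\<^sub>d Y) \<otimes>\<^sub>d Z) (X \<otimes>\<^sub>d (Y \<otimes>\<^sub>d Z)) (assoc X Y Z))
      (strength k R (X \<otimes>\<^sub>d Y) Z) =
    compose (carrier ((X \<otimes>\<^sub>d Y) \<otimes>\<^sub>d \<V> k R Z))
      (strength k R X (Y \<otimes>\<^sub>d Z))
      (compose (carrier ((X \<otimes>\<^sub>d Y) \<otimes>\<^sub>d \<V> k R Z))
        (prod_hom X (Y \<otimes>\<^sub>d \<V> k R Z) (id_hom X) (strength k R Y Z))
        (assoc X Y (\<V> k R Z)))"
    (is "?lhs = ?rhs")
proof (rule dcpo_hom_\<V>_eqI)
  note po' = partial_order_prod[OF po(1,2)] partial_order_prod[OF po(2,3)]
  note as = assoc_dcpo_hom[of X Y Z]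
  show "?lhs \<in> dcpo_hom ((X \<otimes>\<^sub>d Y) \<otimes>\<^sub>d \<V> k R Z) (\<V> k R (X \<otimes>\<^sub>d (Y \<otimes>\<^sub>d Z)))"
    by (rule dcpo_hom_compose[OF strength_hom[OF po'(1) po(3)] \<V>_map_hom[OF as]])
  show "?rhs \<in> dcpo_hom ((X \<otimes>\<^sub>d Y) \<otimes>\<^sub>d \<V> k R Z) (\<V> k R (X \<otimes>\<^sub>d (Y \<otimes>\<^sub>d Z)))"
    by (rule dcpo_hom_compose[OF dcpo_hom_compose[OF assoc_dcpo_hom
            prod_hom_dcpo_hom[OF id_hom_dcpo_hom strength_hom[OF po(2,3)]]] strength_hom[OF po(1) po'(2)]])
  fix p h assume p: "p \<in> carrier ((X \<otimes>\<^sub>d Y) \<otimes>\<^sub>d \<V> k R Z)" and h: "h \<in> cmaps R (X \<otimes>\<^sub>d (Y \<otimes>\<^sub>d Z))"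
  obtain x y \<nu> where xy: "p = ((x, y), \<nu>)" "x \<in> carrier X" "y \<in> carrier Y"
    and \<nu>: "\<nu> \<in> carrier (\<V> k R Z)"
    using p by auto
  have q: "(x, y) \<in> carrier (X \<otimes>\<^sub>d Y)" using xy by simp
  have "?lhs p h = \<V>_map k R ((X \<otimes>\<^sub>d Y) \<otimes>\<^sub>d Z) (X \<otimes>\<^sub>d (Y \<otimes>\<^sub>d Z)) (assoc X Y Z)
      (strength k R (X \<otimes>\<^sub>d Y) Z ((x, y), \<nu>)) h"
    using p by (simp add: compose_eq xy(1))
  also have "\<dots> = strength k R (X \<otimes>\<^sub>d Y) Z ((x, y), \<nu>)
      (\<lambda>q\<in>carrier ((X \<otimes>\<^sub>d Y) \<otimes>\<^sub>d Z). h (assoc X Y Z q))"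
    by (rule \<V>_map_apply[OF as strength_in[OF po'(1) q \<nu>] h])
  also have "\<dots> = \<nu> (\<lambda>z\<in>carrier Z. (\<lambda>q\<in>carrier ((X \<otimes>\<^sub>d Y) \<otimes>\<^sub>d Z). h (assoc X Y Z q)) ((x, y), z))"
    by (rule strength_apply[OF q \<nu> cmaps_compose[OF as h]])
  also have "\<dots> = \<nu> (\<lambda>z\<in>carrier Z. (\<lambda>r\<in>carrier (Y \<otimes>\<^sub>d Z). h (x, r)) (y, z))"
    by (intro arg_cong[of _ _ \<nu>] restrict_ext) (simp add: assoc_def xy)
  also have "\<dots> = strength k R Y Z (y, \<nu>) (\<lambda>r\<in>carrier (Y \<otimes>\<^sub>d Z). h (x, r))"
    by (rule strength_apply[OF xy(3) \<nu> section_cmaps[OF po(1) xy(2) h], symmetric])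
  also have "\<dots> = strength k R X (Y \<otimes>\<^sub>d Z) (x, strength k R Y Z (y, \<nu>)) h"
    by (rule strength_apply[OF xy(2) strength_in[OF po(2) xy(3) \<nu>] h, symmetric])
  also have "\<dots> = ?rhs p h"
    using p by (simp add: compose_eq xy(1) prod_hom_def id_hom_def assoc_def)
  finally show "?lhs p h = ?rhs p h" .
qed

lemma strength_\<eta>:
  fixes R :: "'r::abelian_d_rag itself"
  assumes po: "partial_order X" "partial_order Y"
  shows "compose (carrier (X \<otimes>\<^sub>d Y)) (strength k R X Y) (prod_hom X Y (id_hom X) (\<eta> R Y)) =
    \<eta> R (X \<otimes>\<^sub>d Y)"
    (is "?lhs = _")
proof (rule dcpo_hom_\<V>_eqI)
  show "?lhs \<in> dcpo_hom (X \<otimes>\<^sub>d Y) (\<V> k R (X \<otimes>\<^sub>d Y))"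
    by (rule dcpo_hom_compose[OF prod_hom_dcpo_hom[OF id_hom_dcpo_hom \<eta>_hom] strength_hom[OF po]])
  show "\<eta> R (X \<otimes>\<^sub>d Y) \<in> dcpo_hom (X \<otimes>\<^sub>d Y) (\<V> k R (X \<otimes>\<^sub>d Y))"
    by (rule \<eta>_hom)
  fix p h assume p: "p \<in> carrier (X \<otimes>\<^sub>d Y)" and h: "h \<in> cmaps R (X \<otimes>\<^sub>d Y)"
  obtain x y where xy: "p = (x, y)" "x \<in> carrier X" "y \<in> carrier Y"
    using p by auto
  have "?lhs p h = strength k R X Y (x, \<eta> R Y y) h"
    using p by (simp add: compose_eq xy(1) prod_hom_def id_hom_def)
  also have "\<dots> = \<eta> R Y y (\<lambda>y\<in>carrier Y. h (x, y))"
    by (rule strength_apply[OF xy(2) \<eta>_in[OF xy(3)] h])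
  also have "\<dots> = h (x, y)"
    using \<eta>_apply[OF xy(3) section_cmaps[OF po(1) xy(2) h]] xy(3) by simp
  also have "\<dots> = \<eta> R (X \<otimes>\<^sub>d Y) p h"
    using \<eta>_apply[OF p h] by (simp add: xy(1))
  finally show "?lhs p h = \<eta> R (X \<otimes>\<^sub>d Y) p h" .
qed

text \<open>At \<open>(x, \<xi>)\<close> and \<open>h\<close>, both sides are \<xi> applied to the
  map that sends \<nu> to its value at the section of \<open>h\<close> at \<open>x\<close>.\<close>

lemma strength_\<mu>:
  fixes R :: "'r::abelian_d_rag itself"
  assumes po: "partial_order X" "partial_order Y"
  shows "compose (carrier (X \<otimes>\<^sub>d \<V> k R (\<V> k R Y)))
      (strength k R X Y) (prod_hom X (\<V> k R (\<V> k R Y)) (id_hom X) (\<mu> k R Y)) =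
    compose (carrier (X \<otimes>\<^sub>d \<V> k R (\<V> k R Y)))
      (\<mu> k R (X \<otimes>\<^sub>d Y))
      (compose (carrier (X \<otimes>\<^sub>d \<V> k R (\<V> k R Y)))
        (\<V>_map k R (X \<otimes>\<^sub>d \<V> k R Y) (\<V> k R (X \<otimes>\<^sub>d Y)) (strength k R X Y))
        (strength k R X (\<V> k R Y)))"
    (is "?lhs = ?rhs")
proof (rule dcpo_hom_\<V>_eqI)
  note t = strength_hom[OF po, of k R]
  have "partial_order (\<V> k R Y)" using dcpo_\<V>[of k R Y] by (simp add: dcpo_def)
  note t' = strength_hom[OF po(1) this, of k R]
  show "?lhs \<in> dcpo_hom (X \<otimes>\<^sub>d \<V> k R (\<V> k R Y)) (\<V> k R (X \<otimes>\<^sub>d Y))"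
    by (rule dcpo_hom_compose[OF prod_hom_dcpo_hom[OF id_hom_dcpo_hom \<mu>_hom] t])
  show "?rhs \<in> dcpo_hom (X \<otimes>\<^sub>d \<V> k R (\<V> k R Y)) (\<V> k R (X \<otimes>\<^sub>d Y))"
    by (rule dcpo_hom_compose[OF dcpo_hom_compose[OF t' \<V>_map_hom[OF t]] \<mu>_hom])
  fix p h assume p: "p \<in> carrier (X \<otimes>\<^sub>d \<V> k R (\<V> k R Y))" and h: "h \<in> cmaps R (X \<otimes>\<^sub>d Y)"
  obtain x \<xi> where x: "p = (x, \<xi>)" "x \<in> carrier X" and \<xi>: "\<xi> \<in> carrier (\<V> k R (\<V> k R Y))"
    using p by auto
  \<comment> \<open>Multiplication evaluates a valuation on valuations at this continuous map; on
    the right-hand side it is pulled back along the strength.\<close>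
  let ?ev = "\<lambda>\<omega>\<in>carrier (\<V> k R (X \<otimes>\<^sub>d Y)). \<omega> h"
  have ev: "?ev \<in> cmaps R (\<V> k R (X \<otimes>\<^sub>d Y))"
    by (rule restrict_cmaps[OF scott_continuous_\<V>_eval[OF h]])
  have st: "strength k R X (\<V> k R Y) (x, \<xi>) \<in> carrier (\<V> k R (X \<otimes>\<^sub>d \<V> k R Y))"
    by (rule strength_in[OF po(1) x(2) \<xi>])
  have "?lhs p h = strength k R X Y (x, \<mu> k R Y \<xi>) h"
    using p by (simp add: compose_eq x(1) prod_hom_def id_hom_def)
  also have "\<dots> = \<mu> k R Y \<xi> (\<lambda>y\<in>carrier Y. h (x, y))"
    by (rule strength_apply[OF x(2) dcpo_hom_in[OF \<mu>_hom \<xi>] h])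
  also have "\<dots> = \<xi> (\<lambda>\<nu>\<in>carrier (\<V> k R Y). \<nu> (\<lambda>y\<in>carrier Y. h (x, y)))"
    by (rule \<mu>_apply[OF \<xi> section_cmaps[OF po(1) x(2) h]])
  also have "\<dots> = \<xi> (\<lambda>\<nu>\<in>carrier (\<V> k R Y).
      (\<lambda>q\<in>carrier (X \<otimes>\<^sub>d \<V> k R Y). ?ev (strength k R X Y q)) (x, \<nu>))"
    by (intro arg_cong[of _ _ \<xi>] restrict_ext)
      (simp add: x(2) strength_in[OF po(1) x(2)] strength_apply[OF x(2) _ h])
  also have "\<dots> = strength k R X (\<V> k R Y) (x, \<xi>)
      (\<lambda>q\<in>carrier (X \<otimes>\<^sub>d \<V> k R Y). ?ev (strength k R X Y q))"
    by (rule strength_apply[OF x(2) \<xi> cmaps_compose[OF t ev], symmetric])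
  also have "\<dots> = \<V>_map k R (X \<otimes>\<^sub>d \<V> k R Y) (\<V> k R (X \<otimes>\<^sub>d Y)) (strength k R X Y)
      (strength k R X (\<V> k R Y) (x, \<xi>)) ?ev"
    by (rule \<V>_map_apply[OF t st ev, symmetric])
  also have "\<dots> = \<mu> k R (X \<otimes>\<^sub>d Y) (\<V>_map k R (X \<otimes>\<^sub>d \<V> k R Y) (\<V> k R (X \<otimes>\<^sub>d Y)) (strength k R X Y)
      (strength k R X (\<V> k R Y) (x, \<xi>))) h"
    by (rule \<mu>_apply[OF dcpo_hom_in[OF \<V>_map_hom[OF t] st] h, symmetric])
  also have "\<dots> = ?rhs p h"
    using p by (simp add: compose_eq x(1))
  finally show "?lhs p h = ?rhs p h" .
qed

text \<open>The tag \<open>k\<close> is arbitrary, so one proof covers both monads. Naturality is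
  stated in both variables at once, with the functor action derived from Kleisli extension.\<close>

theorem proposition5p8:
  fixes R :: "'r::abelian_d_rag itself" and k :: valuation_kind
    and X :: "'x gorder" and X' :: "'x' gorder"
    and Y :: "'y gorder" and Y' :: "'y' gorder" and Z :: "'z gorder"
  assumes "dcpo X" "dcpo X'" "dcpo Y" "dcpo Y'" "dcpo Z"
  shows
    \<comment> \<open>Manes monad\<close>
    "dcpo (\<V> k R X) \<and>
     \<eta> R X \<in> dcpo_hom X (\<V> k R X) \<and>
     (\<forall>f\<in>dcpo_hom X (\<V> k R Y). ext k R X Y f \<in> dcpo_hom (\<V> k R X) (\<V> k R Y)) \<and>
     (\<forall>f\<in>dcpo_hom X (\<V> k R Y). compose (carrier X) (ext k R X Y f) (\<eta> R X) = f) \<and>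
     ext k R X X (\<eta> R X) = id_hom (\<V> k R X) \<and>
     (\<forall>f\<in>dcpo_hom X (\<V> k R Y). \<forall>g\<in>dcpo_hom Y (\<V> k R Z).
        ext k R X Z (compose (carrier X) (ext k R Y Z g) f) =
        compose (carrier (\<V> k R X)) (ext k R Y Z g) (ext k R X Y f)) \<and>
     \<comment> \<open>strength: morphism, naturality\<close>
     strength k R X Y \<in> dcpo_hom (X \<otimes>\<^sub>d \<V> k R Y) (\<V> k R (X \<otimes>\<^sub>d Y)) \<and>
     (\<forall>f\<in>dcpo_hom X X'. \<forall>g\<in>dcpo_hom Y Y'.
        compose (carrier (X \<otimes>\<^sub>d \<V> k R Y))
          (\<V>_map k R (X \<otimes>\<^sub>d Y) (X' \<otimes>\<^sub>d Y') (prod_hom X Y f g)) (strength k R X Y) =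
        compose (carrier (X \<otimes>\<^sub>d \<V> k R Y))
          (strength k R X' Y') (prod_hom X (\<V> k R Y) f (\<V>_map k R Y Y' g))) \<and>
     \<comment> \<open>coherence with the unit and associativity isomorphisms\<close>
     compose (carrier (one_dcpo \<otimes>\<^sub>d \<V> k R X))
       (\<V>_map k R (one_dcpo \<otimes>\<^sub>d X) X (unitor X)) (strength k R one_dcpo X) =
       unitor (\<V> k R X) \<and>
     compose (carrier ((X \<otimes>\<^sub>d Y) \<otimes>\<^sub>d \<V> k R Z))
       (\<V>_map k R ((X \<otimes>\<^sub>d Y) \<otimes>\<^sub>d Z) (X \<otimes>\<^sub>d (Y \<otimes>\<^sub>d Z)) (assoc X Y Z))
       (strength k R (X \<otimes>\<^sub>d Y) Z) =
     compose (carrier ((X \<otimes>\<^sub>d Y) \<otimes>\<^sub>d \<V> k R Z))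
       (strength k R X (Y \<otimes>\<^sub>d Z))
       (compose (carrier ((X \<otimes>\<^sub>d Y) \<otimes>\<^sub>d \<V> k R Z))
         (prod_hom X (Y \<otimes>\<^sub>d \<V> k R Z) (id_hom X) (strength k R Y Z))
         (assoc X Y (\<V> k R Z))) \<and>
     \<comment> \<open>coherence with the unit and the multiplication of the monad\<close>
     compose (carrier (X \<otimes>\<^sub>d Y)) (strength k R X Y) (prod_hom X Y (id_hom X) (\<eta> R Y)) =
       \<eta> R (X \<otimes>\<^sub>d Y) \<and>
     compose (carrier (X \<otimes>\<^sub>d \<V> k R (\<V> k R Y)))
       (strength k R X Y) (prod_hom X (\<V> k R (\<V> k R Y)) (id_hom X) (\<mu> k R Y)) =
     compose (carrier (X \<otimes>\<^sub>d \<V> k R (\<V> k R Y)))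
       (\<mu> k R (X \<otimes>\<^sub>d Y))
       (compose (carrier (X \<otimes>\<^sub>d \<V> k R (\<V> k R Y)))
         (\<V>_map k R (X \<otimes>\<^sub>d \<V> k R Y) (\<V> k R (X \<otimes>\<^sub>d Y)) (strength k R X Y))
         (strength k R X (\<V> k R Y)))"
proof -
  note po = assms[unfolded dcpo_def, THEN conjunct1]
  show ?thesis
    using po by (intro conjI ballI dcpo_\<V> \<eta>_hom ext_hom ext_\<eta> ext_\<eta>_id ext_ext strength_hom
        strength_natural strength_unitor strength_assoc strength_\<eta> strength_\<mu>)
qed

end
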